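(* Let $r,t\in\mathcal{U}$, $s\in\mathcal{U}_0$, and let $p=(p_k)_{k\ge 0}$ be a bounded sequence of strictly positive real numbers with $H=\sup_kp_k$. (a) If $p_k>1$ for all $k$, then $[l(r,s,t,p;\Delta)]^\alpha=H_5(p)$; if $0<p_k\le1$ for all $k$, then $[l(r,s,t,p;\Delta)]^\alpha=H_4(p)$. (b) If $0<p_k\le H<\infty$ for all $k$, then (i) $[c_0(r,s,t,p;\Delta)]^\alpha=H_1(p)$, (ii) $[c(r,s,t,p;\Delta)]^\alpha=H_1(p)\cap H_2(p)$, (iii) $[l_\infty(r,s,t,p;\Delta)]^\alpha=H_3(p)$.
   Context: Let $w$ be the space of all real (or complex) sequences $x=(x_n)_{n\in\mathbb{N}_0}$. $\mathcal{U}=\{u\in w: u_n\neq 0\ \forall n\}$ and $\mathcal{U}_0=\{u\in w: u_0\ne 0\}$. Maddox's spaces: $l_\infty(p)=\{x\in w:\sup_k|x_k|^{p_k}<\infty\}$, $c(p)=\{x\in w:\lim_k|x_k-l|^{p_k}=0\text{ for some scalar }l\}$, $c_0(p)=\{x\in w:\lim_k|x_k|^{p_k}=0\}$, $l(p)=\{x\in w:\sum_k|x_k|^{p_k}<\infty\}$. Put $\Delta x_k=x_k-x_{k-1}$ with $x_{-1}=0$. For $X\in\{l_\infty(p),c(p),c_0(p),l(p)\}$, $$X(r,s,t,p;\Delta)=\Big\{x\in w:\Big(\frac1{r_n}\sum_{k=0}^n s_{n-k}t_k\Delta x_k\Big)_n\in X\Big\},$$ written $l_\infty(r,s,t,p;\Delta)$,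 $c(r,s,t,p;\Delta)$, $c_0(r,s,t,p;\Delta)$, $l(r,s,t,p;\Delta)$ respectively. For $U\subseteq w$, the $\alpha$-dual is $U^\alpha=\{a\in w:(a_nu_n)_n\in l_1\ \forall u\in U\}$. $D_0^{(s)}=1/s_0$ and, for $n\ge1$, $D_n^{(s)}=s_0^{-(n+1)}\det(s_{i-j+1})_{1\le i,j\le n}$ with $s_m=0$ for $m<0$. If $p_k>1$, $p_k'=p_k/(p_k-1)$. $F$ ranges over the finite subsets of $\mathbb{N}_0$; sums with upper limit less than lower limit are $0$. Define $$H_1(p)=\bigcup_{L\in\mathbb{N}}\Big\{a\in w:\sup_F\sum_{n=0}^\infty\Big|\sum_{k\in F}\sum_{j=0}^{n-k}(-1)^j\frac{D_j^{(s)}}{t_{j+k}}r_ka_nL^{-1/p_k}\Big|<\infty\Big\},$$ $$H_2(p)=\Big\{a\in w:\sum_{n=0}^\infty\Big|\sum_{k=0}^{\infty}\sum_{j=0}^{n-k}(-1)^j\frac{D_j^{(s)}}{t_{j+k}}r_ka_n\Big|<\infty\Big\},$$ $$H_3(p)=\bigcap_{L\in\mathbb{N}}\Big\{a\in w:\sup_F\sum_{n=0}^\infty\Big|\sum_{k\in F}\sum_{j=0}^{n-k}(-1)^j\frac{D_j^{(s)}}{t_{j+k}}r_ka_nL^{1/p_k}\Big|<\infty\Big\},$$ $$H_4(p)=\Big\{a\in w:\sup_F\sup_{k\in\mathbb{N}_0}\Big|\sum_{n\in F}\sum_{j=0}^{n-k}(-1)^j\frac{D_j^{(s)}}{t_{j+k}}r_ka_n\Big|^{p_k}<\infty\Big\},$$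 $$H_5(p)=\bigcup_{L\in\mathbb{N}}\Big\{a\in w:\sup_F\sum_{k=0}^\infty\Big|\sum_{n\in F}\sum_{j=0}^{n-k}(-1)^j\frac{D_j^{(s)}}{t_{j+k}}r_ka_nL^{-1}\Big|^{p_k'}<\infty\Big\}.$$ *)

theory Defs
  imports
    "HOL-Library.Extended_Nonnegative_Real"
    "HOL-Analysis.Euclidean_Space"
    "Jordan_Normal_Form.Determinant"
begin

text \<open>
  Scalars are elements of a type \<open>'a\<close> that is both a \<open>real_normed_field\<close> and a
  \<open>euclidean_space\<close>, that is, a finite-dimensional real field with multiplicative norm.
  Both \<open>real\<close> and \<open>complex\<close> are instances, and up to isometric isomorphism there are no others.
  The space of all sequences is the type \<open>nat \<Rightarrow> 'a\<close>.
\<close>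

definition seqs_nonzero :: "(nat \<Rightarrow> 'a::zero) set" where
  "seqs_nonzero = {u. \<forall>n. u n \<noteq> 0}"

definition seqs_nonzero0 :: "(nat \<Rightarrow> 'a::zero) set" where
  "seqs_nonzero0 = {u. u 0 \<noteq> 0}"

definition maddox_linf :: "(nat \<Rightarrow> real) \<Rightarrow> (nat \<Rightarrow> 'a::{real_normed_field,euclidean_space}) set" where
  "maddox_linf p = {x. bdd_above (range (\<lambda>k. norm (x k) powr p k))}"

definition maddox_c :: "(nat \<Rightarrow> real) \<Rightarrow> (nat \<Rightarrow> 'a::{real_normed_field,euclidean_space}) set" where
  "maddox_c p = {x. \<exists>l. (\<lambda>k. norm (x k - l) powr p k) \<longlonglongrightarrow> 0}"

definition maddox_c0 :: "(nat \<Rightarrow> real) \<Rightarrow> (nat \<Rightarrow> 'a::{real_normed_field,euclidean_space}) set" where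
  "maddox_c0 p = {x. (\<lambda>k. norm (x k) powr p k) \<longlonglongrightarrow> 0}"

definition maddox_l :: "(nat \<Rightarrow> real) \<Rightarrow> (nat \<Rightarrow> 'a::{real_normed_field,euclidean_space}) set" where
  "maddox_l p = {x. summable (\<lambda>k. norm (x k) powr p k)}"

definition bdiff :: "(nat \<Rightarrow> 'a::ab_group_add) \<Rightarrow> nat \<Rightarrow> 'a" where
  "bdiff x k = x k - (if k = 0 then 0 else x (k - 1))"

text \<open>For \<open>X = maddox_l p\<close> and so on, this is the space written \<open>X(r, s, t, p; \<Delta>)\<close>.\<close>

definition mean_diff_space ::
    "(nat \<Rightarrow> 'a) set \<Rightarrow> (nat \<Rightarrow> 'a) \<Rightarrow> (nat \<Rightarrow> 'a) \<Rightarrow> (nat \<Rightarrow> 'a)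
      \<Rightarrow> (nat \<Rightarrow> 'a::{real_normed_field,euclidean_space}) set" where
  "mean_diff_space X r s t =
    {x. (\<lambda>n. 1 / r n * (\<Sum>k=0..n. s (n - k) * t k * bdiff x k)) \<in> X}"

definition ell1 :: "(nat \<Rightarrow> 'a::{real_normed_field,euclidean_space}) set" where
  "ell1 = {x. summable (\<lambda>n. norm (x n))}"

definition alpha_dual ::
    "(nat \<Rightarrow> 'a) set \<Rightarrow> (nat \<Rightarrow> 'a::{real_normed_field,euclidean_space}) set" where
  "alpha_dual U = {a. \<forall>u\<in>U. (\<lambda>n. a n * u n) \<in> ell1}"

text \<open>
  Matrix indices start at 0 here; the entry \<open>s\<^bsub>i-j+1\<^esub>\<close> depends only on \<open>i - j\<close>, so the
  matrix is the one with indices from \<open>1\<close> to \<open>n\<close>. The conditional encodes \<open>s\<^sub>m = 0\<close> for \<open>m < 0\<close>.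
\<close>

definition D_seq :: "(nat \<Rightarrow> 'a::field) \<Rightarrow> nat \<Rightarrow> 'a" where
  "D_seq s n = (if n = 0 then 1 / s 0
     else det (mat n n (\<lambda>(i, j). if j \<le> i + 1 then s (i + 1 - j) else 0)) / s 0 ^ (n + 1))"

text \<open>
  The inner sum over \<open>j = 0, \<dots>, n - k\<close>. The index set is written without subtraction, since
  truncated subtraction would leave the term \<open>j = 0\<close> when \<open>k > n\<close>, where the sum is empty.
\<close>

definition hterm ::
    "(nat \<Rightarrow> 'a::field) \<Rightarrow> (nat \<Rightarrow> 'a) \<Rightarrow> (nat \<Rightarrow> 'a) \<Rightarrow> (nat \<Rightarrow> 'a) \<Rightarrow> nat \<Rightarrow> nat \<Rightarrow> 'a" where
  "hterm r s t a n k = (\<Sum>j | j + k \<le> n. (- 1) ^ j * (D_seq s j / t (j + k)) * r k * a n)"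

text \<open>
  Suprema and series of nonnegative terms are taken in \<open>ennreal\<close>, so that finiteness of the value
  also expresses convergence. The index \<open>L\<close> ranges over the positive integers.
\<close>

definition H1 :: "(nat \<Rightarrow> 'a) \<Rightarrow> (nat \<Rightarrow> 'a) \<Rightarrow> (nat \<Rightarrow> 'a) \<Rightarrow> (nat \<Rightarrow> real)
      \<Rightarrow> (nat \<Rightarrow> 'a::{real_normed_field,euclidean_space}) set" where
  "H1 r s t p = (\<Union>L\<in>{1::nat..}. {a.
    (SUP F\<in>{F. finite F}. \<Sum>n. ennreal (norm
      (\<Sum>k\<in>F. hterm r s t a n k * of_real (real L powr (- 1 / p k))))) < \<infinity>})"

definition H2 :: "(nat \<Rightarrow> 'a) \<Rightarrow> (nat \<Rightarrow> 'a) \<Rightarrow> (nat \<Rightarrow> 'a) \<Rightarrow> (nat \<Rightarrow> real)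
      \<Rightarrow> (nat \<Rightarrow> 'a::{real_normed_field,euclidean_space}) set" where
  "H2 r s t p = {a. (\<Sum>n. ennreal (norm (\<Sum>k. hterm r s t a n k))) < \<infinity>}"

definition H3 :: "(nat \<Rightarrow> 'a) \<Rightarrow> (nat \<Rightarrow> 'a) \<Rightarrow> (nat \<Rightarrow> 'a) \<Rightarrow> (nat \<Rightarrow> real)
      \<Rightarrow> (nat \<Rightarrow> 'a::{real_normed_field,euclidean_space}) set" where
  "H3 r s t p = (\<Inter>L\<in>{1::nat..}. {a.
    (SUP F\<in>{F. finite F}. \<Sum>n. ennreal (norm
      (\<Sum>k\<in>F. hterm r s t a n k * of_real (real L powr (1 / p k))))) < \<infinity>})"

definition H4 :: "(nat \<Rightarrow> 'a) \<Rightarrow> (nat \<Rightarrow> 'a) \<Rightarrow> (nat \<Rightarrow> 'a) \<Rightarrow> (nat \<Rightarrow> real)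
      \<Rightarrow> (nat \<Rightarrow> 'a::{real_normed_field,euclidean_space}) set" where
  "H4 r s t p = {a.
    (SUP F\<in>{F. finite F}. SUP k. ennreal (norm (\<Sum>n\<in>F. hterm r s t a n k) powr p k)) < \<infinity>}"

definition H5 :: "(nat \<Rightarrow> 'a) \<Rightarrow> (nat \<Rightarrow> 'a) \<Rightarrow> (nat \<Rightarrow> 'a) \<Rightarrow> (nat \<Rightarrow> real)
      \<Rightarrow> (nat \<Rightarrow> 'a::{real_normed_field,euclidean_space}) set" where
  "H5 r s t p = (\<Union>L\<in>{1::nat..}. {a.
    (SUP F\<in>{F. finite F}. \<Sum>k. ennreal (norm
      (\<Sum>n\<in>F. hterm r s t a n k * inverse (of_nat L)) powr (p k / (p k - 1)))) < \<infinity>})"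

end

theory Submission
  imports Defs "HOL-Analysis.Convex" "HOL-Computational_Algebra.Formal_Power_Series"
begin

text \<open>
  Up to diagonal factors, the mean difference operator is backward difference followed by
  convolution with \<open>s\<close>; it is inverted by the reciprocal of the power series of \<open>s\<close>, whose
  coefficients are the determinants \<open>D\<^sub>j\<close> up to sign. So \<open>a\<close> lies in
  the dual iff the lower triangular matrix \<^const>\<open>hterm\<close> maps the Maddox space into \<open>\<ell>\<^sub>1\<close>.
  Sufficiency of the conditions is an elementary estimate: in finite dimension, bounds on all finite
  subset sums bound the sum of norms. For necessity, suppose a condition fails. Then there are
  arbitrarily late, arbitrarily small, finitely supported sequences with arbitrarily large image.
  As row \<open>n\<close> of the matrix sees only the coordinates up to \<open>n\<close>, such blocks can be
  concatenated without disturbing the norms already collected, and the result is a member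
  of the space whose image is not absolutely summable.
\<close>

subsection \<open>Inverting the mean difference operator\<close>

text \<open>Cramer's rule for the last entry of the solution of \<open>T x = e\<^sub>0\<close>, where \<open>T\<close> is the lower
  triangular Toeplitz matrix of \<open>s\<close>: the minor that survives is the determinant in \<^const>\<open>D_seq\<close>.\<close>

lemma inverse_fps_nth_eq_D_seq:
  fixes s :: "nat \<Rightarrow> 'a::field"
  assumes s0: "s 0 \<noteq> 0"
  shows "fps_nth (inverse (Abs_fps s)) n = (- 1) ^ n * D_seq s n"
proof (cases "n = 0")
  case True
  then show ?thesis using s0 by (simp add: D_seq_def divide_inverse)
next
  case False
  define g where "g = inverse (Abs_fps s)"
  define T where "T = mat (Suc n) (Suc n) (\<lambda>(i, j). if j \<le> i then s (i - j) else 0)"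
  define e where "e = vec (Suc n) (\<lambda>i. if i = 0 then 1 else 0 :: 'a)"
  define x where "x = vec (Suc n) (\<lambda>j. fps_nth g j)"
  have T: "T \<in> carrier_mat (Suc n) (Suc n)"
    by (simp add: T_def)
  have x: "x \<in> carrier_vec (Suc n)"
    by (simp add: x_def)
  have xn: "x $ n = fps_nth g n"
    by (simp add: x_def)
  \<comment> \<open>Row \<open>i\<close> of this system is the coefficient of index \<open>i\<close>
    in \<open>g * Abs_fps s = 1\<close>; the system is triangular, so it can be cut off after
    \<open>n\<close>.\<close>
  have Tx: "T *\<^sub>v x = e"
  proof (rule eq_vecI)
    fix i assume "i < dim_vec e"
    then have i: "i \<le> n" by (simp add: e_def)
    have "(T *\<^sub>v x) $ i = (\<Sum>j\<in>{0..<Suc n}. (if j \<le> i then s (i - j) else 0) * fps_nth g j)"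
      using i by (simp add: T_def x_def scalar_prod_def)
    also have "\<dots> = (\<Sum>j\<in>{0..i}. (if j \<le> i then s (i - j) else 0) * fps_nth g j)"
      using i by (intro sum.mono_neutral_right) auto
    also have "\<dots> = fps_nth (g * Abs_fps s) i"
      unfolding fps_mult_nth by (intro sum.cong) (auto simp: mult.commute)
    also have "\<dots> = e $ i"
      using i s0 by (simp add: g_def e_def inverse_mult_eq_1)
    finally show "(T *\<^sub>v x) $ i = e $ i" .
  qed (simp add: T_def e_def)
  have detT: "det T = s 0 ^ Suc n"
  proof -
    have "det T = prod_list (diag_mat T)"
      by (rule det_lower_triangular[OF _ T]) (auto simp: T_def)
    also have "diag_mat T = replicate (Suc n) (s 0)"
      unfolding diag_mat_def by (rule nth_equalityI) (auto simp: T_def simp del: upt_Suc replicate_Suc)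
    finally show ?thesis by (simp del: replicate_Suc)
  qed
  define R where "R = replace_col T e n"
  have R: "R \<in> carrier_mat (Suc n) (Suc n)"
    by (simp add: R_def replace_col_def T_def)
  have "det R = (\<Sum>i<Suc n. R $$ (i, n) * cofactor R i n)"
    by (rule laplace_expansion_column[OF R]) simp
  also have "\<dots> = (\<Sum>i\<in>{0}. R $$ (i, n) * cofactor R i n)"
    by (rule sum.mono_neutral_right) (auto simp: R_def replace_col_def T_def e_def)
  also have "\<dots> = cofactor R 0 n"
    by (simp add: R_def replace_col_def T_def e_def)
  also have "\<dots> = (- 1) ^ n * det (mat_delete R 0 n)"
    by (simp add: cofactor_def)
  \<comment> \<open>Deleting row 0 raises the row index by one, which produces the entries
    \<open>s (i + 1 - j)\<close> with \<open>s 0\<close> on the superdiagonal.\<close>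
  also have "mat_delete R 0 n = mat n n (\<lambda>(i, j). if j \<le> i + 1 then s (i + 1 - j) else 0)"
    by (rule eq_matI) (auto simp: mat_delete_def R_def replace_col_def T_def)
  finally have "det R = (- 1) ^ n * (D_seq s n * s 0 ^ Suc n)"
    using False s0 by (simp add: D_seq_def)
  moreover have "det R = fps_nth g n * s 0 ^ Suc n"
    using cramer_lemma_mat[OF T x, of n] xn by (simp add: R_def Tx detT)
  ultimately show ?thesis
    using s0 by (simp add: g_def)
qed

lemma bdiff_eq_iff: "bdiff x = v \<longleftrightarrow> (\<forall>n. x n = (\<Sum>k\<le>n. v k))"
proof
  assume "bdiff x = v"
  moreover have "x n = (\<Sum>k\<le>n. bdiff x k)" for n
    by (induction n) (simp_all add: bdiff_def)
  ultimately show "\<forall>n. x n = (\<Sum>k\<le>n. v k)" by simp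
next
  assume "\<forall>n. x n = (\<Sum>k\<le>n. v k)"
  then show "bdiff x = v"
    by (auto simp: bdiff_def fun_eq_iff gr0_conv_Suc)
qed

text \<open>In terms of power series the mean says \<open>U * S = Y\<close>, and
  \<open>s 0 \<noteq> 0\<close> makes \<open>S\<close> invertible; dividing by \<open>t\<close> and
  summing the differences then recovers \<open>x\<close>. The equivalence gives injectivity and
  surjectivity at once.\<close>

lemma mean_diff_eq_iff:
  fixes r s t x y :: "nat \<Rightarrow> 'a::field"
  assumes r: "\<And>n. r n \<noteq> 0" and t: "\<And>n. t n \<noteq> 0" and s0: "s 0 \<noteq> 0"
  shows "(\<forall>n. y n = 1 / r n * (\<Sum>k=0..n. s (n - k) * t k * bdiff x k)) \<longleftrightarrow>
    (\<forall>n. x n = (\<Sum>k\<le>n. (\<Sum>j | j + k \<le> n. (- 1) ^ j * (D_seq s j / t (j + k))) * r k * y k))"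
    (is "?L \<longleftrightarrow> ?R")
proof -
  define S where "S = Abs_fps s"
  define U where "U = Abs_fps (\<lambda>k. t k * bdiff x k)"
  define Y where "Y = Abs_fps (\<lambda>k. r k * y k)"
  define g where "g j = (- 1) ^ j * D_seq s j" for j
  define v where "v k = (\<Sum>i=0..k. r i * y i * g (k - i)) / t k" for k
  have S0: "fps_nth S 0 \<noteq> 0" using s0 by (simp add: S_def)
  have g: "fps_nth (inverse S) n = g n" for n
    unfolding S_def g_def by (rule inverse_fps_nth_eq_D_seq[where s = s, OF s0])
  have "?L \<longleftrightarrow> (\<forall>n. (\<Sum>k=0..n. s (n - k) * t k * bdiff x k) = r n * y n)"
    using r by (auto simp: field_simps)
  also have "\<dots> \<longleftrightarrow> U * S = Y"
  proof -
    have "s (n - k) * t k * bdiff x k = t k * bdiff x k * s (n - k)" for n k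
      by (simp add: mult_ac)
    then show ?thesis
      by (simp only: fps_eq_iff fps_mult_nth U_def S_def Y_def fps_nth_Abs_fps)
  qed
  also have "\<dots> \<longleftrightarrow> U = Y * inverse S"
  proof
    assume "U * S = Y"
    then have "Y * inverse S = U * (S * inverse S)" by (simp add: mult.assoc)
    then show "U = Y * inverse S" by (simp add: inverse_mult_eq_1'[OF S0])
  next
    assume "U = Y * inverse S"
    then have "U * S = Y * (inverse S * S)" by (simp add: mult.assoc)
    then show "U * S = Y" by (simp add: inverse_mult_eq_1[OF S0])
  qed
  also have "\<dots> \<longleftrightarrow> (\<forall>k. t k * bdiff x k = (\<Sum>i=0..k. r i * y i * g (k - i)))"
    by (simp add: fps_eq_iff fps_mult_nth U_def Y_def g)
  also have "\<dots> \<longleftrightarrow> bdiff x = v"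
  proof -
    have "t k * b = c \<longleftrightarrow> b = c / t k" for b c k
      using t[of k] by (auto simp: eq_divide_eq mult.commute)
    then show ?thesis by (simp only: v_def fun_eq_iff)
  qed
  also have "\<dots> \<longleftrightarrow> (\<forall>n. x n = (\<Sum>k\<le>n. v k))"
    by (rule bdiff_eq_iff)
  also have "\<dots> \<longleftrightarrow> ?R"
  proof -
    have "(\<Sum>k\<le>n. v k) =
      (\<Sum>k\<le>n. (\<Sum>j | j + k \<le> n. (- 1) ^ j * (D_seq s j / t (j + k))) * r k * y k)" for n
    proof -
      have "(\<Sum>k\<le>n. v k) = (\<Sum>k\<le>n. \<Sum>i\<le>k. r i * y i * g (k - i) / t k)"
        by (simp add: v_def sum_divide_distrib atMost_atLeast0)
      \<comment> \<open>The order of summation is exchanged with \<open>j = k - i\<close>; the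
        resulting index set \<open>j + i \<le> n\<close> is the one in \<open>hterm\<close>.\<close>
      also have "\<dots> = (\<Sum>i\<le>n. \<Sum>j | j + i \<le> n. r i * y i * g j / t (j + i))"
      proof -
        have fin: "finite {j. j + i \<le> n}" for i
          by (rule finite_subset[of _ "{..n}"]) auto
        have "(\<Sum>(k, i)\<in>(SIGMA k:{..n}. {..k}). r i * y i * g (k - i) / t k) =
            (\<Sum>(i, j)\<in>(SIGMA i:{..n}. {j. j + i \<le> n}). r i * y i * g j / t (j + i))"
          by (rule sum.reindex_bij_witness[of _ "\<lambda>(i, j). (j + i, i)" "\<lambda>(k, i). (i, k - i)"]) auto
        then show ?thesis
          by (simp add: sum.Sigma fin)
      qed
      also have "\<dots> = (\<Sum>k\<le>n. (\<Sum>j | j + k \<le> n. (- 1) ^ j * (D_seq s j / t (j + k))) * r k * y k)"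
        by (simp add: sum_distrib_right sum_distrib_left g_def mult_ac)
      finally show ?thesis .
    qed
    then show ?thesis by (simp only:)
  qed
  finally show ?thesis .
qed

text \<open>Cutting row \<open>n\<close> off after column \<open>n\<close> keeps the sum finite for
  every \<open>y\<close>; for a matrix that vanishes above the diagonal it is the full row.\<close>

definition tri_apply :: "(nat \<Rightarrow> nat \<Rightarrow> 'a) \<Rightarrow> (nat \<Rightarrow> 'a) \<Rightarrow> nat \<Rightarrow> 'a::semiring_0" where
  "tri_apply C y n = (\<Sum>k\<le>n. C n k * y k)"

definition maps_ell1 :: "(nat \<Rightarrow> 'a) set \<Rightarrow> (nat \<Rightarrow> nat \<Rightarrow> 'a::real_normed_field) \<Rightarrow> bool" where
  "maps_ell1 X C \<longleftrightarrow> (\<forall>y\<in>X. summable (\<lambda>n. norm (tri_apply C y n)))"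

lemma hterm_eq: "hterm r s t a n k =
    a n * ((\<Sum>j | j + k \<le> n. (- 1) ^ j * (D_seq s j / t (j + k))) * r k)"
  by (simp add: hterm_def sum_distrib_right sum_distrib_left mult_ac)

lemma hterm_eq_0: "n < k \<Longrightarrow> hterm r s t a n k = 0"
  by (simp add: hterm_def)

text \<open>The members of the mean difference space are exactly the \<open>V y\<close> with
  \<open>y \<in> X\<close>, and \<open>a n * V y n\<close> is row \<open>n\<close> of
  \<open>hterm\<close> applied to \<open>y\<close>.\<close>

lemma alpha_dual_mean_diff_space:
  fixes r s t :: "nat \<Rightarrow> 'a::{real_normed_field,euclidean_space}"
  assumes r: "\<And>n. r n \<noteq> 0" and t: "\<And>n. t n \<noteq> 0" and s0: "s 0 \<noteq> 0"
  shows "a \<in> alpha_dual (mean_diff_space X r s t) \<longleftrightarrow>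
    maps_ell1 X (hterm r s t a)"
proof -
  define T where "T x n = 1 / r n * (\<Sum>k=0..n. s (n - k) * t k * bdiff x k)" for x n
  define V where "V y n = (\<Sum>k\<le>n. (\<Sum>j | j + k \<le> n. (- 1) ^ j * (D_seq s j / t (j + k))) * r k * y k)"
    for y n
  have eq: "y = T x \<longleftrightarrow> x = V y" for x y
    using mean_diff_eq_iff[of r t s y x, OF r t s0] by (simp add: T_def V_def fun_eq_iff)
  have V: "a n * V y n = tri_apply (hterm r s t a) y n" for y n
    by (simp add: V_def tri_apply_def hterm_eq sum_distrib_left mult_ac)
  have "mean_diff_space X r s t = {x. T x \<in> X}"
    by (simp add: mean_diff_space_def T_def[abs_def])
  also have "\<dots> = V ` X"
  proof -
    \<comment> \<open>The two directions of \<open>eq\<close> make \<open>V\<close> and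
      \<open>T\<close> mutually inverse, so the preimage of \<open>X\<close> under \<open>T\<close>
      is its image under \<open>V\<close>.\<close>
    have inv: "V (T x) = x" "T (V y) = y" for x y
      by (rule eq[THEN iffD1, OF refl, symmetric], rule eq[THEN iffD2, OF refl, symmetric])
    show ?thesis
    proof (intro equalityI subsetI)
      fix x assume "x \<in> {x. T x \<in> X}"
      then show "x \<in> V ` X" using inv(1)[of x] by (intro rev_image_eqI[of "T x"]) simp_all
    next
      fix x assume "x \<in> V ` X"
      then show "x \<in> {x. T x \<in> X}" using inv(2) by auto
    qed
  qed
  finally have "mean_diff_space X r s t = V ` X" .
  then show ?thesis
    by (simp add: alpha_dual_def ell1_def maps_ell1_def V)
qed

subsection \<open>Triangular matrices and absolutely summable images\<close>

lemma tri_apply_cong: "(\<And>k. k \<le> n \<Longrightarrow> y k = z k) \<Longrightarrow> tri_apply C y n = tri_apply C z n"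
  by (simp add: tri_apply_def)

lemma tri_apply_add: "tri_apply C (\<lambda>k. y k + z k) n = tri_apply C y n + tri_apply C z n"
  by (simp add: tri_apply_def algebra_simps sum.distrib)

lemma tri_apply_finite_support:
  assumes tri: "\<And>n k. n < k \<Longrightarrow> C n k = 0" and F: "finite F" and z: "\<And>k. k \<notin> F \<Longrightarrow> z k = 0"
  shows "tri_apply C z n = (\<Sum>k\<in>F. C n k * z k)"
proof -
  have "tri_apply C z n = (\<Sum>k\<in>{..n} \<union> F. C n k * z k)"
    unfolding tri_apply_def by (rule sum.mono_neutral_left) (use F tri in auto)
  also have "\<dots> = (\<Sum>k\<in>F. C n k * z k)"
    by (rule sum.mono_neutral_right) (use F z in auto)
  finally show ?thesis .
qed

lemma sum_tri_apply:
  assumes tri: "\<And>n k. n < k \<Longrightarrow> C n k = 0" and G: "finite G" "G \<subseteq> {..<N}"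
  shows "(\<Sum>n\<in>G. tri_apply C y n) = (\<Sum>k<N. (\<Sum>n\<in>G. C n k) * y k)"
proof -
  have "tri_apply C y n = (\<Sum>k<N. C n k * y k)" if "n \<in> G" for n
    unfolding tri_apply_def by (rule sum.mono_neutral_left) (use G that tri in auto)
  then show ?thesis
    by (simp add: sum.swap[of _ G] sum_distrib_right)
qed

text \<open>In each coordinate the terms of one sign form a subset sum, so partial sums of norms are
  at most \<open>2 * DIM('a)\<close> times the bound.\<close>

lemma summable_norm_if_finite_sums_bounded:
  fixes v :: "nat \<Rightarrow> 'a::euclidean_space"
  assumes "\<And>G. finite G \<Longrightarrow> norm (sum v G) \<le> B"
  shows "summable (\<lambda>n. norm (v n))"
proof (rule bounded_imp_summable)
  fix n
  show "(\<Sum>k\<le>n. norm (v k)) \<le> 2 * real DIM('a) * B"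
    by (rule sum_norm_allsubsets_bound) (auto intro: assms finite_subset)
qed simp

text \<open>Summing the image over a finite row set \<open>G\<close> and exchanging sums pairs
  \<open>y\<close> with the column sums of \<open>C\<close> over \<open>G\<close>. A bound on this
  pairing, uniform in \<open>G\<close> and \<open>N\<close>, therefore bounds all subset sums of the
  image.\<close>

lemma summable_tri_apply:
  fixes C :: "nat \<Rightarrow> nat \<Rightarrow> 'a::{real_normed_field,euclidean_space}"
  assumes tri: "\<And>n k. n < k \<Longrightarrow> C n k = 0"
    and B: "\<And>G N. finite G \<Longrightarrow> (\<Sum>k<N. norm (\<Sum>n\<in>G. C n k) * norm (y k)) \<le> B"
  shows "summable (\<lambda>n. norm (tri_apply C y n))"
proof (rule summable_norm_if_finite_sums_bounded)
  fix G :: "nat set" assume G: "finite G"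
  then obtain N where N: "G \<subseteq> {..<N}"
    using finite_nat_iff_bounded by blast
  have "norm (\<Sum>n\<in>G. tri_apply C y n) \<le> (\<Sum>k<N. norm (\<Sum>n\<in>G. C n k) * norm (y k))"
    by (subst sum_tri_apply[of C, OF tri G N]) (auto intro: sum_norm_le simp: norm_mult)
  also have "\<dots> \<le> B" by (rule B[OF G])
  finally show "norm (\<Sum>n\<in>G. tri_apply C y n) \<le> B" .
qed

text \<open>Bounds on the sums over finite rectangles pass from sums of row norms to sums of column norms and
  back, each time at the cost of the factor \<open>2 DIM('a)\<close> in \<open>sum_norm_allsubsets_bound\<close>.\<close>

lemma summable_tri_apply_weighted:
  fixes C :: "nat \<Rightarrow> nat \<Rightarrow> 'a::{real_normed_field,euclidean_space}"
  assumes tri: "\<And>n k. n < k \<Longrightarrow> C n k = 0"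
    and w: "\<And>k. 0 < w k"
    and B: "\<And>F N. finite F \<Longrightarrow> (\<Sum>n<N. norm (\<Sum>k\<in>F. C n k * of_real (w k))) \<le> B"
    and y: "\<And>k. norm (y k) \<le> M * w k"
  shows "summable (\<lambda>n. norm (tri_apply C y n))"
proof (rule summable_tri_apply[OF tri])
  fix G :: "nat set" and N assume G: "finite G"
  define \<beta> where "\<beta> k = (\<Sum>n\<in>G. C n k * of_real (w k))" for k
  have M: "0 \<le> M"
    using y[of 0] w[of 0] by (smt (verit) norm_ge_zero zero_le_mult_iff)
  have "(\<Sum>k<N. norm (\<beta> k)) \<le> 2 * real DIM('a) * B"
  proof (rule sum_norm_allsubsets_bound)
    fix F assume "F \<subseteq> {..<N}"
    then have F: "finite F" by (rule finite_subset) simp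
    obtain N' where N': "G \<subseteq> {..<N'}"
      using G finite_nat_iff_bounded by blast
    have "norm (sum \<beta> F) = norm (\<Sum>n\<in>G. \<Sum>k\<in>F. C n k * of_real (w k))"
      unfolding \<beta>_def by (subst sum.swap) simp
    also have "\<dots> \<le> (\<Sum>n\<in>G. norm (\<Sum>k\<in>F. C n k * of_real (w k)))"
      by (rule norm_sum)
    also have "\<dots> \<le> (\<Sum>n<N'. norm (\<Sum>k\<in>F. C n k * of_real (w k)))"
      by (rule sum_mono2) (use N' in auto)
    also have "\<dots> \<le> B" by (rule B[OF F])
    finally show "norm (sum \<beta> F) \<le> B" .
  qed simp
  moreover have "norm (\<Sum>n\<in>G. C n k) * norm (y k) \<le> M * norm (\<beta> k)" for k
  proof -
    have "norm (\<beta> k) = norm (\<Sum>n\<in>G. C n k) * w k"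
      using w[of k] by (simp add: \<beta>_def norm_mult flip: sum_distrib_right)
    then show ?thesis
      using mult_left_mono[OF y[of k] norm_ge_zero[of "\<Sum>n\<in>G. C n k"]] by (simp add: mult_ac)
  qed
  then have "(\<Sum>k<N. norm (\<Sum>n\<in>G. C n k) * norm (y k)) \<le> M * (\<Sum>k<N. norm (\<beta> k))"
    unfolding sum_distrib_left by (rule sum_mono)
  ultimately show "(\<Sum>k<N. norm (\<Sum>n\<in>G. C n k) * norm (y k)) \<le> M * (2 * real DIM('a) * B)"
    using M by (meson mult_left_mono order_trans)
qed

lemma sum_le_suminf_norm:
  fixes v :: "nat \<Rightarrow> 'a::real_normed_vector"
  assumes "summable (\<lambda>n. norm (v n))" "finite G"
  shows "norm (sum v G) \<le> (\<Sum>n. norm (v n))"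
  using norm_sum[of v G] sum_le_suminf[OF assms] by simp

subsection \<open>A gliding hump\<close>

text \<open>\<open>Q i\<close> is the size condition on block \<open>i\<close>, left open because
  each Maddox space asks for a different one. Humps must exist beyond every \<open>K\<close>, to
  separate the supports, and above every \<open>M\<close>, to outweigh the image of the earlier
  blocks. With \<open>\<kappa> 0 = 0\<close> the blocks cover all indices.\<close>

lemma gliding_hump:
  fixes C :: "nat \<Rightarrow> nat \<Rightarrow> 'a::real_normed_field"
  assumes tri: "\<And>n k. n < k \<Longrightarrow> C n k = 0"
    and col: "\<And>k. summable (\<lambda>n. norm (C n k))"
    and hump: "\<And>i K M. \<exists>z F N. finite F \<and> F \<subseteq> {K..} \<and> (\<forall>k. k \<notin> F \<longrightarrow> z k = 0) \<and> Q i z \<and>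
      M \<le> (\<Sum>n<N. norm (tri_apply C z n))"
  shows "\<exists>y \<kappa>. strict_mono \<kappa> \<and> \<kappa> 0 = 0 \<and>
    (\<forall>i. Q i (\<lambda>k. if \<kappa> i \<le> k \<and> k < \<kappa> (Suc i) then y k else 0)) \<and>
    \<not> summable (\<lambda>n. norm (tri_apply C y n))"
proof -
  \<comment> \<open>A stage is a pair \<open>(w, K)\<close> of a sequence and a bound for its
    support. \<open>R\<close> demands that the next stage keep the coordinates below
    \<open>K\<close>, add a block satisfying \<open>Q i\<close>, and have an image of mass at least
    \<open>i\<close> in the rows below \<open>K'\<close>.\<close>
  define P where "P = (\<lambda>(i :: nat) (w :: nat \<Rightarrow> 'a, K). (i = 0 \<longrightarrow> K = 0) \<and> (\<forall>k\<ge>K. w k = 0))"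
  define R where "R = (\<lambda>(i :: nat) (w :: nat \<Rightarrow> 'a, K) (w' :: nat \<Rightarrow> 'a, K'). K < K' \<and> (\<forall>k<K. w' k = w k) \<and>
    Q i (\<lambda>k. if K \<le> k \<and> k < K' then w' k else 0) \<and>
    real i \<le> (\<Sum>n<K'. norm (tri_apply C w' n)))"
  have step: "\<exists>q'. P (Suc i) q' \<and> R i q q'" if "P i q" for i q
  proof -
    obtain w K where q: "q = (w, K)" by (cases q)
    have w: "w k = 0" if "k \<ge> K" for k
      using \<open>P i q\<close> that by (simp add: P_def q)
    \<comment> \<open>Summable columns bound the image of the finitely supported \<open>w\<close>,
      uniformly in the number of rows.\<close>
    define A where "A = (\<Sum>k<K. (\<Sum>n. norm (C n k)) * norm (w k))"
    have A: "(\<Sum>n<N. norm (tri_apply C w n)) \<le> A" for N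
    proof -
      have "(\<Sum>n<N. norm (tri_apply C w n)) \<le> (\<Sum>n<N. \<Sum>k<K. norm (C n k) * norm (w k))"
      proof (rule sum_mono)
        fix n
        have "tri_apply C w n = (\<Sum>k<K. C n k * w k)"
          by (rule tri_apply_finite_support[OF tri]) (use w in auto)
        then show "norm (tri_apply C w n) \<le> (\<Sum>k<K. norm (C n k) * norm (w k))"
          by (simp add: sum_norm_le norm_mult)
      qed
      also have "\<dots> = (\<Sum>k<K. (\<Sum>n<N. norm (C n k)) * norm (w k))"
        by (subst sum.swap) (simp add: sum_distrib_right)
      also have "\<dots> \<le> A"
        unfolding A_def by (intro sum_mono mult_right_mono sum_le_suminf col) auto
      finally show ?thesis .
    qed
    \<comment> \<open>Asking for \<open>A + real i\<close> leaves \<open>real i\<close> after the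
      old part has cancelled at most \<open>A\<close>.\<close>
    obtain z F N where F: "finite F" "F \<subseteq> {K..}" and z: "\<And>k. k \<notin> F \<Longrightarrow> z k = 0" "Q i z"
      and N: "A + real i \<le> (\<Sum>n<N. norm (tri_apply C z n))"
      using hump[of K i "A + real i"] by blast
    obtain K1 where K1: "F \<subseteq> {..<K1}"
      using F finite_nat_iff_bounded by blast
    \<comment> \<open>The new end exceeds \<open>K\<close> for strict growth, \<open>N\<close> to
      include the rows counted, and \<open>K1\<close> to enclose the support of
      \<open>z\<close>.\<close>
    define K' where "K' = Max {Suc K, N, K1}"
    have K': "K < K'" "N \<le> K'" "K1 \<le> K'"
      by (auto simp: K'_def)
    define w' where "w' k = w k + z k" for k
    have zK: "z k = 0" if "k < K" for k
      using z(1)[of k] F that by force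
    have zK': "z k = 0" if "k \<ge> K'" for k
      using z(1)[of k] K1 K' that by force
    have block: "(\<lambda>k. if K \<le> k \<and> k < K' then w' k else 0) = z"
      using w zK zK' by (auto simp: w'_def fun_eq_iff)
    have "A + real i \<le> (\<Sum>n<K'. norm (tri_apply C z n))"
      using N sum_mono2[of "{..<K'}" "{..<N}" "\<lambda>n. norm (tri_apply C z n)"] K' by force
    also have "\<dots> \<le> (\<Sum>n<K'. norm (tri_apply C w' n) + norm (tri_apply C w n))"
    proof (rule sum_mono)
      fix n
      show "norm (tri_apply C z n) \<le> norm (tri_apply C w' n) + norm (tri_apply C w n)"
        using norm_triangle_ineq4[of "tri_apply C w' n" "tri_apply C w n"]
        by (simp add: w'_def[abs_def] tri_apply_add)
    qed
    also have "\<dots> \<le> (\<Sum>n<K'. norm (tri_apply C w' n)) + A"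
      using A[of K'] by (simp add: sum.distrib)
    finally have "real i \<le> (\<Sum>n<K'. norm (tri_apply C w' n))" by simp
    then have "P (Suc i) (w', K') \<and> R i q (w', K')"
      using K' w zK zK' z(2) block by (auto simp: P_def R_def q w'_def)
    then show ?thesis by blast
  qed
  have "\<exists>q. P 0 q"
    by (rule exI[of _ "(\<lambda>_. 0, 0)"]) (simp add: P_def)
  from dependent_nat_choice[of P R, OF this step]
  obtain f where f: "\<And>i. P i (f i)" "\<And>i. R i (f i) (f (Suc i))"
    by blast
  define W where "W i = fst (f i)" for i
  define \<kappa> where "\<kappa> i = snd (f i)" for i
  have \<kappa>0: "\<kappa> 0 = 0"
    using f(1)[of 0] by (simp add: P_def \<kappa>_def case_prod_beta)
  have R: "\<kappa> i < \<kappa> (Suc i)" "\<And>k. k < \<kappa> i \<Longrightarrow> W (Suc i) k = W i k"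
    "Q i (\<lambda>k. if \<kappa> i \<le> k \<and> k < \<kappa> (Suc i) then W (Suc i) k else 0)"
    "real i \<le> (\<Sum>n<\<kappa> (Suc i). norm (tri_apply C (W (Suc i)) n))" for i
    using f(2)[of i] unfolding R_def \<kappa>_def W_def case_prod_beta by auto
  have mono: "strict_mono \<kappa>"
    by (simp add: strict_mono_Suc_iff R(1))
  then have \<kappa>_ge: "i \<le> \<kappa> i" for i
    by (rule strict_mono_imp_increasing)
  have W: "W j k = W i k" if "i \<le> j" "k < \<kappa> i" for i j k
    using that
  proof (induction j rule: dec_induct)
    case (step j)
    then have "k < \<kappa> j"
      using mono by (meson less_le_trans strict_mono_less_eq)
    then show ?case using R(2)[of k j] step by simp
  qed simp
  \<comment> \<open>Coordinate \<open>k\<close> is final from stage \<open>Suc k\<close> on, since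
    \<open>k < \<kappa> (Suc k)\<close>.\<close>
  define y where "y k = W (Suc k) k" for k
  have y: "y k = W i k" if "k < \<kappa> i" for i k
  proof (cases "i \<le> Suc k")
    case True
    then show ?thesis using W[of i "Suc k" k] that by (simp add: y_def)
  next
    case False
    then show ?thesis using W[of "Suc k" i k] \<kappa>_ge[of "Suc k"] by (simp add: y_def)
  qed
  have blocks: "Q i (\<lambda>k. if \<kappa> i \<le> k \<and> k < \<kappa> (Suc i) then y k else 0)" for i
  proof -
    have "(\<lambda>k. if \<kappa> i \<le> k \<and> k < \<kappa> (Suc i) then y k else 0) =
        (\<lambda>k. if \<kappa> i \<le> k \<and> k < \<kappa> (Suc i) then W (Suc i) k else 0)"
      by (auto simp: fun_eq_iff y)
    then show ?thesis using R(3)[of i] by simp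
  qed
  have "\<not> summable (\<lambda>n. norm (tri_apply C y n))"
  proof
    assume sm: "summable (\<lambda>n. norm (tri_apply C y n))"
    obtain i where i: "(\<Sum>n. norm (tri_apply C y n)) < real i"
      using reals_Archimedean2 by blast
    have "real i \<le> (\<Sum>n<\<kappa> (Suc i). norm (tri_apply C (W (Suc i)) n))"
      by (rule R(4))
    \<comment> \<open>Rows below \<open>\<kappa> (Suc i)\<close> read only coordinates on which
      \<open>y\<close> and \<open>W (Suc i)\<close> agree.\<close>
    also have "\<dots> = (\<Sum>n<\<kappa> (Suc i). norm (tri_apply C y n))"
      by (intro sum.cong refl arg_cong[where f = norm] tri_apply_cong) (auto intro!: y[symmetric])
    also have "\<dots> \<le> (\<Sum>n. norm (tri_apply C y n))"
      by (rule sum_le_suminf[OF sm]) auto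
    finally show False using i by simp
  qed
  then show ?thesis
    using mono \<kappa>0 blocks by blast
qed

text \<open>Finitely many columns contribute only a bounded amount, so an unbounded family of finite row sums
  stays unbounded after the first \<open>K\<close> columns are dropped.\<close>

lemma weighted_hump:
  fixes C :: "nat \<Rightarrow> nat \<Rightarrow> 'a::real_normed_field"
  assumes tri: "\<And>n k. n < k \<Longrightarrow> C n k = 0"
    and col: "\<And>k. summable (\<lambda>n. norm (C n k))"
    and unbdd: "\<And>B. \<exists>F N. finite F \<and> B < (\<Sum>n<N. norm (\<Sum>k\<in>F. C n k * w k))"
  shows "\<exists>z F N. finite F \<and> F \<subseteq> {K..} \<and> (\<forall>k. k \<notin> F \<longrightarrow> z k = 0) \<and> (\<forall>k\<in>F. z k = w k) \<and>
      M \<le> (\<Sum>n<N. norm (tri_apply C z n))"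
proof -
  define A where "A = (\<Sum>k<K. (\<Sum>n. norm (C n k)) * norm (w k))"
  obtain F N where F: "finite F" and N: "M + A < (\<Sum>n<N. norm (\<Sum>k\<in>F. C n k * w k))"
    using unbdd by blast
  define z where "z k = (if k \<in> F \<inter> {K..} then w k else 0)" for k
  have z: "tri_apply C z n = (\<Sum>k\<in>F \<inter> {K..}. C n k * w k)" for n
    using F by (subst tri_apply_finite_support[of C "F \<inter> {K..}", OF tri]) (auto simp: z_def)
  have "norm (\<Sum>k\<in>F. C n k * w k) \<le>
      norm (tri_apply C z n) + (\<Sum>k<K. norm (C n k) * norm (w k))" for n
  proof -
    have "F = (F \<inter> {K..}) \<union> (F \<inter> {..<K})" by auto
    then have "(\<Sum>k\<in>F. C n k * w k) = tri_apply C z n + (\<Sum>k\<in>F \<inter> {..<K}. C n k * w k)"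
      unfolding z using F by (subst sum.union_disjoint[symmetric]) auto
    moreover have "norm (\<Sum>k\<in>F \<inter> {..<K}. C n k * w k) \<le> (\<Sum>k\<in>F \<inter> {..<K}. norm (C n k) * norm (w k))"
      by (rule sum_norm_le) (simp add: norm_mult)
    moreover have "\<dots> \<le> (\<Sum>k<K. norm (C n k) * norm (w k))"
      by (rule sum_mono2) auto
    ultimately show ?thesis
      using norm_triangle_ineq[of "tri_apply C z n" "\<Sum>k\<in>F \<inter> {..<K}. C n k * w k"] by simp
  qed
  then have "(\<Sum>n<N. norm (\<Sum>k\<in>F. C n k * w k)) \<le>
      (\<Sum>n<N. norm (tri_apply C z n) + (\<Sum>k<K. norm (C n k) * norm (w k)))"
    by (rule sum_mono)
  also have "\<dots> = (\<Sum>n<N. norm (tri_apply C z n)) + (\<Sum>k<K. (\<Sum>n<N. norm (C n k)) * norm (w k))"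
    by (simp add: sum.distrib sum_distrib_right sum.swap[of _ "{..<N}" "{..<K}"])
  also have "(\<Sum>k<K. (\<Sum>n<N. norm (C n k)) * norm (w k)) \<le> A"
    unfolding A_def by (intro sum_mono mult_right_mono sum_le_suminf col) auto
  finally have "M \<le> (\<Sum>n<N. norm (tri_apply C z n))" using N by simp
  then show ?thesis
    using F by (intro exI[of _ z] exI[of _ "F \<inter> {K..}"] exI[of _ N]) (auto simp: z_def)
qed

text \<open>The block is found by the greatest \<open>j\<close> with
  \<open>\<kappa> j \<le> k\<close>; it exists because \<open>j \<le> \<kappa> j\<close> bounds the
  candidates by \<open>k\<close>.\<close>

lemma strict_mono_block:
  fixes \<kappa> :: "nat \<Rightarrow> nat"
  assumes "strict_mono \<kappa>" "\<kappa> i \<le> k"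
  shows "\<exists>j\<ge>i. \<kappa> j \<le> k \<and> k < \<kappa> (Suc j)"
proof -
  have bound: "\<And>j. \<kappa> j \<le> k \<Longrightarrow> j \<le> k"
    using strict_mono_imp_increasing[OF assms(1)] order_trans by blast
  define j where "j = (GREATEST j. \<kappa> j \<le> k)"
  have "\<kappa> j \<le> k" "i \<le> j" "\<not> \<kappa> (Suc j) \<le> k"
    unfolding j_def using assms(2) bound
    by (auto intro: GreatestI_nat Greatest_le_nat dest: Greatest_le_nat[OF _ bound])
  then show ?thesis by auto
qed
subsection \<open>Matrix transformations of the Maddox spaces into \<open>\<ell>\<^sub>1\<close>\<close>

text \<open>Column \<open>k\<close> is the image of the \<open>k\<close>-th unit sequence. This
  supplies the column hypothesis of \<open>gliding_hump\<close>.\<close>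

lemma maps_ell1_column:
  assumes "\<And>n k. n < k \<Longrightarrow> C n k = 0" "maps_ell1 X C" "(\<lambda>j. if j = k then 1 else 0) \<in> X"
  shows "summable (\<lambda>n. norm (C n k))"
proof -
  have "tri_apply C (\<lambda>j. if j = k then 1 else 0) n = C n k" for n
    using tri_apply_finite_support[of C "{k}" "\<lambda>j. if j = k then 1 else 0" n] assms(1) by simp
  then show ?thesis
    using assms(2,3) by (force simp: maps_ell1_def)
qed

lemma le_powr_inverse:
  fixes x :: real
  assumes "0 \<le> x" "0 < p" "x powr p \<le> c"
  shows "x \<le> c powr (1 / p)"
proof -
  have "x = (x powr p) powr (1 / p)"
    using assms by (simp add: powr_powr)
  also have "\<dots> \<le> c powr (1 / p)"
    using assms by (intro powr_mono2) auto
  finally show ?thesis .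
qed

section \<open>Null, bounded and convergent sequences\<close>

text \<open>The weight \<open>L powr (- 1 / p k)\<close> is the number whose power
  \<open>p k\<close> is \<open>1 / L\<close>. A null sequence eventually lies below these weights,
  whatever \<open>L\<close> is. If the bound fails for every \<open>L\<close>, humps made of the
  weights for \<open>L = Suc i\<close> concatenate to a null sequence.\<close>

lemma maps_ell1_maddox_c0_iff:
  fixes C :: "nat \<Rightarrow> nat \<Rightarrow> 'a::{real_normed_field,euclidean_space}"
  assumes tri: "\<And>n k. n < k \<Longrightarrow> C n k = 0" and p: "\<And>k. 0 < p k"
  shows "maps_ell1 (maddox_c0 p) C \<longleftrightarrow> (\<exists>L\<ge>1::nat. \<exists>B. \<forall>F N. finite F \<longrightarrow>
    (\<Sum>n<N. norm (\<Sum>k\<in>F. C n k * of_real (real L powr (- 1 / p k)))) \<le> B)"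
    (is "_ \<longleftrightarrow> (\<exists>L\<ge>1. \<exists>B. ?bound L B)")
proof
  assume maps: "maps_ell1 (maddox_c0 p) C"
  show "\<exists>L\<ge>1. \<exists>B. ?bound L B"
  proof (rule ccontr)
    assume neg: "\<not> (\<exists>L\<ge>1. \<exists>B. ?bound L B)"
    define Q where "Q i z \<longleftrightarrow> (\<forall>k. norm (z k) powr p k \<le> 1 / real (Suc i))" for i and z :: "nat \<Rightarrow> 'a"
    have "(\<lambda>j. norm (if j = k then 1 else 0 :: 'a) powr p j) \<longlonglongrightarrow> 0" for k
      by (rule tendsto_eventually, rule eventually_sequentiallyI[of "Suc k"]) auto
    then have col: "summable (\<lambda>n. norm (C n k))" for k
      by (intro maps_ell1_column[OF tri maps]) (simp_all add: maddox_c0_def)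
    have hump: "\<exists>z F N. finite F \<and> F \<subseteq> {K..} \<and> (\<forall>k. k \<notin> F \<longrightarrow> z k = 0) \<and> Q i z \<and>
      M \<le> (\<Sum>n<N. norm (tri_apply C z n))" for i K M
    proof -
      define w :: "nat \<Rightarrow> 'a" where "w k = of_real (real (Suc i) powr (- 1 / p k))" for k
      have "\<exists>F N. finite F \<and> B < (\<Sum>n<N. norm (\<Sum>k\<in>F. C n k * w k))" for B
      proof -
        have "1 \<le> Suc i" by simp
        then have "\<not> ?bound (Suc i) B" using neg by blast
        then show ?thesis unfolding w_def not_le[symmetric] by blast
      qed
      then obtain z F N where z: "finite F" "F \<subseteq> {K..}" "\<forall>k. k \<notin> F \<longrightarrow> z k = 0" "\<forall>k\<in>F. z k = w k"
        "M \<le> (\<Sum>n<N. norm (tri_apply C z n))"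
        using weighted_hump[of C w K M, OF tri col] by blast
      have "norm (w k) powr p k = 1 / real (Suc i)" for k
      proof -
        have "norm (w k) powr p k = (real (Suc i) powr (- 1 / p k)) powr p k"
          by (simp add: w_def)
        also have "\<dots> = real (Suc i) powr (- 1)"
          unfolding powr_powr using p[of k] by simp
        also have "\<dots> = 1 / real (Suc i)"
          by (simp only: powr_minus_divide powr_one of_nat_0_le_iff)
        finally show ?thesis .
      qed
      then have "norm (z k) powr p k \<le> 1 / real (Suc i)" for k
        using z(3,4) by (cases "k \<in> F") auto
      then show ?thesis
        using z by (intro exI[of _ z] exI[of _ F] exI[of _ N]) (auto simp: Q_def)
    qed
    obtain y \<kappa> where mono: "strict_mono \<kappa>"
      and Q: "\<And>i. Q i (\<lambda>k. if \<kappa> i \<le> k \<and> k < \<kappa> (Suc i) then y k else 0)"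
      and div: "\<not> summable (\<lambda>n. norm (tri_apply C y n))"
      using gliding_hump[of C Q, OF tri col hump] by blast
    have small: "norm (y k) powr p k \<le> 1 / real (Suc i)" if k: "\<kappa> i \<le> k" for i k
    proof -
      obtain j where j: "i \<le> j" "\<kappa> j \<le> k" "k < \<kappa> (Suc j)"
        using strict_mono_block[OF mono k] by blast
      then have "norm (y k) powr p k \<le> 1 / real (Suc j)"
        using Q[of j] unfolding Q_def by (elim allE[of _ k]) simp
      also have "\<dots> \<le> 1 / real (Suc i)"
        using j(1) by (intro divide_left_mono) auto
      finally show ?thesis .
    qed
    have "y \<in> maddox_c0 p"
      unfolding maddox_c0_def mem_Collect_eq
    proof (rule LIMSEQ_I)
      fix e :: real assume "0 < e"
      then obtain i where i: "inverse (real (Suc i)) < e"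
        using reals_Archimedean by blast
      have "norm (norm (y k) powr p k - 0) < e" if "k \<ge> \<kappa> i" for k
        using small[OF that] i by (simp add: inverse_eq_divide)
      then show "\<exists>no. \<forall>n\<ge>no. norm (norm (y n) powr p n - 0) < e"
        by blast
    qed
    then show False
      using maps div by (simp add: maps_ell1_def)
  qed
next
  assume "\<exists>L\<ge>1. \<exists>B. ?bound L B"
  then obtain L B where L: "1 \<le> L" and B: "?bound L B"
    by blast
  define w where "w k = real L powr (- 1 / p k)" for k
  have w: "0 < w k" for k
    using L by (simp add: w_def)
  show "maps_ell1 (maddox_c0 p) C"
    unfolding maps_ell1_def
  proof
    fix y :: "nat \<Rightarrow> 'a" assume "y \<in> maddox_c0 p"
    then have "\<forall>\<^sub>F k in sequentially. norm (y k) powr p k < 1 / L"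
      using L by (intro order_tendstoD(2)[where y = 0]) (auto simp: maddox_c0_def)
    then obtain K where K: "\<And>k. k \<ge> K \<Longrightarrow> norm (y k) powr p k < 1 / L"
      by (auto simp: eventually_sequentially)
    have "(1 / real L) powr (1 / p k) = w k" for k
    proof -
      have "w k = inverse (real L powr (1 / p k))"
        using powr_minus[of "real L" "1 / p k"] by (simp add: w_def)
      then show ?thesis using L by (simp add: powr_divide inverse_eq_divide)
    qed
    then have tail: "norm (y k) \<le> w k" if "k \<ge> K" for k
      using le_powr_inverse[OF norm_ge_zero p less_imp_le[OF K[OF that]]] by metis
    \<comment> \<open>The sum takes care of the finitely many terms before \<open>K\<close>, the
      summand 1 of the tail.\<close>
    define M where "M = 1 + (\<Sum>k<K. norm (y k) / w k)"
    have M: "1 \<le> M"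
      unfolding M_def using less_imp_le[OF w] by (simp add: sum_nonneg)
    show "summable (\<lambda>n. norm (tri_apply C y n))"
    proof (rule summable_tri_apply_weighted[OF tri w])
      show "(\<Sum>n<N. norm (\<Sum>k\<in>F. C n k * of_real (w k))) \<le> B" if "finite F" for F N
        using B that unfolding w_def by blast
      show "norm (y k) \<le> M * w k" for k
      proof (cases "k < K")
        case True
        have "norm (y k) / w k \<le> (\<Sum>k<K. norm (y k) / w k)"
          by (rule member_le_sum[where f = "\<lambda>k. norm (y k) / w k"])
            (use True less_imp_le[OF w] in auto)
        then have "norm (y k) / w k \<le> M" unfolding M_def by linarith
        then show ?thesis using w[of k] by (simp add: pos_divide_le_eq)
      next
        case False
        then have "norm (y k) \<le> 1 * w k" using tail by simp
        also have "\<dots> \<le> M * w k" using M w[of k] by (intro mult_right_mono) auto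
        finally show ?thesis .
      qed
    qed
  qed
qed

text \<open>Here a single failing \<open>L\<close> gives a contradiction, since boundedness allows
  all humps the same height \<open>L\<close>. Conversely, every member of the space is dominated by
  the weights for some \<open>L\<close>.\<close>

lemma maps_ell1_maddox_linf_iff:
  fixes C :: "nat \<Rightarrow> nat \<Rightarrow> 'a::{real_normed_field,euclidean_space}"
  assumes tri: "\<And>n k. n < k \<Longrightarrow> C n k = 0" and p: "\<And>k. 0 < p k"
  shows "maps_ell1 (maddox_linf p) C \<longleftrightarrow> (\<forall>L\<ge>1::nat. \<exists>B. \<forall>F N. finite F \<longrightarrow>
    (\<Sum>n<N. norm (\<Sum>k\<in>F. C n k * of_real (real L powr (1 / p k)))) \<le> B)"
    (is "_ \<longleftrightarrow> (\<forall>L\<ge>1. \<exists>B. ?bound L B)")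
proof
  assume maps: "maps_ell1 (maddox_linf p) C"
  show "\<forall>L\<ge>1. \<exists>B. ?bound L B"
  proof (intro allI impI, rule ccontr)
    fix L :: nat assume L: "1 \<le> L" and neg: "\<not> (\<exists>B. ?bound L B)"
    define Q where "Q = (\<lambda>(i :: nat) z. \<forall>k. norm (z k :: 'a) powr p k \<le> real L)"
    define w :: "nat \<Rightarrow> 'a" where "w k = of_real (real L powr (1 / p k))" for k
    have "bdd_above (range (\<lambda>j. norm (if j = k then 1 else 0 :: 'a) powr p j))" for k
      by (rule bdd_aboveI[of _ 1]) auto
    then have col: "summable (\<lambda>n. norm (C n k))" for k
      by (intro maps_ell1_column[OF tri maps]) (simp_all add: maddox_linf_def)
    have "\<exists>F N. finite F \<and> B < (\<Sum>n<N. norm (\<Sum>k\<in>F. C n k * w k))" for B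
    proof -
      have "\<not> ?bound L B" using neg by blast
      then show ?thesis unfolding w_def not_le[symmetric] by blast
    qed
    note wh = weighted_hump[of C w, OF tri col this]
    have wL: "norm (w k) powr p k = real L" for k
      using p[of k] L by (simp add: w_def powr_powr)
    have hump: "\<exists>z F N. finite F \<and> F \<subseteq> {K..} \<and> (\<forall>k. k \<notin> F \<longrightarrow> z k = 0) \<and> Q i z \<and>
      M \<le> (\<Sum>n<N. norm (tri_apply C z n))" for i K M
    proof -
      obtain z F N where z: "finite F" "F \<subseteq> {K..}" "\<forall>k. k \<notin> F \<longrightarrow> z k = 0" "\<forall>k\<in>F. z k = w k"
        "M \<le> (\<Sum>n<N. norm (tri_apply C z n))"
        using wh[of K M] by blast
      have "norm (z k) powr p k \<le> real L" for k
        using z(3,4) wL[of k] by (cases "k \<in> F") auto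
      then show ?thesis
        using z by (intro exI[of _ z] exI[of _ F] exI[of _ N]) (auto simp: Q_def)
    qed
    obtain y \<kappa> where mono: "strict_mono \<kappa>" "\<kappa> 0 = 0"
      and Q: "\<And>i. Q i (\<lambda>k. if \<kappa> i \<le> k \<and> k < \<kappa> (Suc i) then y k else 0)"
      and div: "\<not> summable (\<lambda>n. norm (tri_apply C y n))"
      using gliding_hump[of C Q, OF tri col hump] by blast
    \<comment> \<open>Boundedness concerns every coordinate and not only a tail, so the blocks must
      start at \<open>\<kappa> 0 = 0\<close>.\<close>
    have "norm (y k) powr p k \<le> real L" for k
    proof -
      obtain j where "\<kappa> j \<le> k" "k < \<kappa> (Suc j)"
        using strict_mono_block[OF mono(1), of 0 k] mono(2) by auto
      then show ?thesis
        using Q[of j] unfolding Q_def by (elim allE[of _ k]) simp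
    qed
    then have "y \<in> maddox_linf p"
      unfolding maddox_linf_def by (auto intro!: bdd_aboveI[of _ "real L"])
    then show False
      using maps div by (simp add: maps_ell1_def)
  qed
next
  assume bound: "\<forall>L\<ge>1. \<exists>B. ?bound L B"
  show "maps_ell1 (maddox_linf p) C"
    unfolding maps_ell1_def
  proof
    fix y :: "nat \<Rightarrow> 'a" assume "y \<in> maddox_linf p"
    then obtain b where b: "\<And>k. norm (y k) powr p k \<le> b"
      by (auto simp: maddox_linf_def bdd_above_def)
    obtain m :: nat where m: "b \<le> real m"
      using real_arch_simple by blast
    \<comment> \<open>The successor ensures \<open>1 \<le> L\<close> even when \<open>m\<close> is
      0.\<close>
    define L where "L = Suc m"
    then have "1 \<le> L" by simp
    then obtain B where B: "?bound L B"
      using bound by blast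
    show "summable (\<lambda>n. norm (tri_apply C y n))"
    proof (rule summable_tri_apply_weighted[OF tri])
      show "0 < real L powr (1 / p k)" for k by (simp add: L_def)
      show "(\<Sum>n<N. norm (\<Sum>k\<in>F. C n k * of_real (real L powr (1 / p k)))) \<le> B" if "finite F" for F N
        using B that by blast
      have "norm (y k) powr p k \<le> real L" for k
        using b[of k] m by (simp add: L_def)
      then show "norm (y k) \<le> 1 * real L powr (1 / p k)" for k
        using le_powr_inverse[OF norm_ge_zero p, of "y k" k "real L"] by simp
    qed
  qed
qed

text \<open>A member of \<open>maddox_c p\<close> with limit \<open>l\<close> is a member of
  \<open>maddox_c0 p\<close> plus the constant \<open>l\<close>. The image of the constant 1 is the
  sequence of row sums, which is what \<open>H2\<close> controls.\<close>

lemma maps_ell1_maddox_c_iff: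
  fixes C :: "nat \<Rightarrow> nat \<Rightarrow> 'a::{real_normed_field,euclidean_space}"
  shows "maps_ell1 (maddox_c p) C \<longleftrightarrow>
    maps_ell1 (maddox_c0 p) C \<and> summable (\<lambda>n. norm (tri_apply C (\<lambda>_. 1) n))"
proof
  assume maps: "maps_ell1 (maddox_c p) C"
  have "maddox_c0 p \<subseteq> (maddox_c p :: (nat \<Rightarrow> 'a) set)"
    unfolding maddox_c0_def maddox_c_def by (auto intro!: exI[of _ 0])
  moreover have "(\<lambda>_. 1) \<in> (maddox_c p :: (nat \<Rightarrow> 'a) set)"
    unfolding maddox_c_def by (auto intro!: exI[of _ 1])
  ultimately show "maps_ell1 (maddox_c0 p) C \<and> summable (\<lambda>n. norm (tri_apply C (\<lambda>_. 1) n))"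
    using maps by (auto simp: maps_ell1_def)
next
  assume maps: "maps_ell1 (maddox_c0 p) C \<and> summable (\<lambda>n. norm (tri_apply C (\<lambda>_. 1) n))"
  show "maps_ell1 (maddox_c p) C"
    unfolding maps_ell1_def
  proof
    fix y :: "nat \<Rightarrow> 'a" assume "y \<in> maddox_c p"
    then obtain l where "(\<lambda>k. y k - l) \<in> maddox_c0 p"
      by (auto simp: maddox_c_def maddox_c0_def)
    then have "summable (\<lambda>n. norm (tri_apply C (\<lambda>k. y k - l) n))"
      using maps by (simp add: maps_ell1_def)
    then have sm: "summable (\<lambda>n. norm (tri_apply C (\<lambda>k. y k - l) n) + norm l * norm (tri_apply C (\<lambda>_. 1) n))"
      using maps by (intro summable_add summable_mult) auto
    have "tri_apply C y n = tri_apply C (\<lambda>k. y k - l) n + l * tri_apply C (\<lambda>_. 1) n" for n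
      by (simp add: tri_apply_def algebra_simps sum_subtractf sum_distrib_left)
    then have "norm (tri_apply C y n) \<le>
        norm (tri_apply C (\<lambda>k. y k - l) n) + norm l * norm (tri_apply C (\<lambda>_. 1) n)" for n
      by (metis norm_triangle_ineq norm_mult)
    then show "summable (\<lambda>n. norm (tri_apply C y n))"
      by (intro summable_comparison_test'[OF sm]) simp
  qed
qed

section \<open>Sequences with summable powers\<close>

text \<open>Block \<open>i\<close> costs at most \<open>(1 / 2) ^ i\<close>, so the geometric series
  bounds the cost of the concatenation, which thus lies in \<open>maddox_l p\<close>.\<close>

lemma gliding_hump_maddox_l:
  fixes C :: "nat \<Rightarrow> nat \<Rightarrow> 'a::{real_normed_field,euclidean_space}"
  assumes tri: "\<And>n k. n < k \<Longrightarrow> C n k = 0"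
    and col: "\<And>k. summable (\<lambda>n. norm (C n k))"
    and hump: "\<And>i K M. \<exists>z F N. finite F \<and> F \<subseteq> {K..} \<and> (\<forall>k. k \<notin> F \<longrightarrow> z k = 0) \<and>
      (\<Sum>k\<in>F. norm (z k) powr p k) \<le> (1 / 2) ^ i \<and> M \<le> (\<Sum>n<N. norm (tri_apply C z n))"
  shows "\<not> maps_ell1 (maddox_l p) C"
proof -
  \<comment> \<open>\<open>gliding_hump\<close> passes only the block to \<open>Q\<close>, not its
    support; ranging over all finite \<open>G\<close> expresses the total cost without it.\<close>
  define Q where "Q i z \<longleftrightarrow> (\<forall>G. finite G \<longrightarrow> (\<Sum>k\<in>G. norm (z k) powr p k) \<le> (1 / 2) ^ i)"
    for i and z :: "nat \<Rightarrow> 'a"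
  have humpQ: "\<exists>z F N. finite F \<and> F \<subseteq> {K..} \<and> (\<forall>k. k \<notin> F \<longrightarrow> z k = 0) \<and> Q i z \<and>
      M \<le> (\<Sum>n<N. norm (tri_apply C z n))" for i K M
  proof -
    obtain z F N where z: "finite F" "F \<subseteq> {K..}" "\<forall>k. k \<notin> F \<longrightarrow> z k = 0"
      "(\<Sum>k\<in>F. norm (z k) powr p k) \<le> (1 / 2) ^ i" "M \<le> (\<Sum>n<N. norm (tri_apply C z n))"
      using hump[of K i M] by blast
    have "(\<Sum>k\<in>G. norm (z k) powr p k) \<le> (1 / 2) ^ i" if "finite G" for G
    proof -
      have "(\<Sum>k\<in>G. norm (z k) powr p k) \<le> (\<Sum>k\<in>G \<union> F. norm (z k) powr p k)"
        by (rule sum_mono2) (use z that in auto)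
      also have "\<dots> = (\<Sum>k\<in>F. norm (z k) powr p k)"
        by (rule sum.mono_neutral_right) (use z that in auto)
      finally show ?thesis using z(4) by simp
    qed
    then show ?thesis
      using z by (intro exI[of _ z] exI[of _ F] exI[of _ N]) (auto simp: Q_def)
  qed
  obtain y \<kappa> where mono: "strict_mono \<kappa>" "\<kappa> 0 = 0"
    and Q: "\<And>i. Q i (\<lambda>k. if \<kappa> i \<le> k \<and> k < \<kappa> (Suc i) then y k else 0)"
    and div: "\<not> summable (\<lambda>n. norm (tri_apply C y n))"
    using gliding_hump[of C Q, OF tri col humpQ] by blast
  have block: "(\<Sum>k\<in>{\<kappa> i..<\<kappa> (Suc i)}. norm (y k) powr p k) \<le> (1 / 2) ^ i" for i
    using Q[of i] unfolding Q_def by (elim allE[of _ "{\<kappa> i..<\<kappa> (Suc i)}"]) simp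
  have partial: "(\<Sum>k<\<kappa> m. norm (y k) powr p k) \<le> (\<Sum>i<m. (1 / 2) ^ i)" for m
  proof (induction m)
    case (Suc m)
    have "\<kappa> m \<le> \<kappa> (Suc m)"
      using mono(1) by (simp add: strict_mono_less_eq)
    then have "(\<Sum>k<\<kappa> (Suc m). norm (y k) powr p k) =
        (\<Sum>k<\<kappa> m. norm (y k) powr p k) + (\<Sum>k\<in>{\<kappa> m..<\<kappa> (Suc m)}. norm (y k) powr p k)"
      by (subst sum.union_disjoint[symmetric]) (auto simp: ivl_disj_un)
    then show ?case using Suc block[of m] by simp
  qed (simp add: mono)
  have "summable (\<lambda>k. norm (y k) powr p k)"
  proof (rule bounded_imp_summable)
    fix n
    have "Suc n \<le> \<kappa> (Suc n)"
      using mono(1) by (rule strict_mono_imp_increasing)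
    then have "(\<Sum>k\<le>n. norm (y k) powr p k) \<le> (\<Sum>k<\<kappa> (Suc n). norm (y k) powr p k)"
      by (intro sum_mono2) auto
    also have "\<dots> \<le> (\<Sum>i<Suc n. (1 / 2) ^ i)"
      by (rule partial)
    also have "\<dots> \<le> (\<Sum>i. (1 / 2) ^ i)"
      by (rule sum_le_suminf) (auto intro: summable_geometric)
    finally show "(\<Sum>k\<le>n. norm (y k) powr p k) \<le> (\<Sum>i. (1 / 2) ^ i)" .
  qed simp
  then show ?thesis
    using div by (auto simp: maps_ell1_def maddox_l_def)
qed

lemma maddox_l_unit: "(\<lambda>j. if j = k then 1 else 0 :: 'a::{real_normed_field,euclidean_space}) \<in> maddox_l p"
  unfolding maddox_l_def mem_Collect_eq by (rule summable_finite[of "{k}"]) auto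

text \<open>This is how humps are recognised below: a sequence \<open>z\<close> that pairs to
  something large with the column sums over \<open>G\<close> has a large image.\<close>

lemma norm_sum_le_sum_norm_tri_apply:
  fixes C :: "nat \<Rightarrow> nat \<Rightarrow> 'a::real_normed_field"
  assumes tri: "\<And>n k. n < k \<Longrightarrow> C n k = 0" and G: "finite G" "G \<subseteq> {..<N}"
  shows "norm (\<Sum>k<N. (\<Sum>n\<in>G. C n k) * z k) \<le> (\<Sum>n<N. norm (tri_apply C z n))"
proof -
  have "norm (\<Sum>k<N. (\<Sum>n\<in>G. C n k) * z k) = norm (\<Sum>n\<in>G. tri_apply C z n)"
    by (subst sum_tri_apply[of C, OF tri G]) auto
  also have "\<dots> \<le> (\<Sum>n\<in>G. norm (tri_apply C z n))"
    by (rule norm_sum)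
  also have "\<dots> \<le> (\<Sum>n<N. norm (tri_apply C z n))"
    by (rule sum_mono2) (use G in auto)
  finally show ?thesis .
qed

text \<open>For exponents at most 1 a scaled unit sequence is already a sufficient hump, so the
  condition tests single columns. Conversely, small products only grow when raised to
  \<open>p k\<close>, which compares the pairing with the convergent series of powers.\<close>

lemma maps_ell1_maddox_l_le1_iff:
  fixes C :: "nat \<Rightarrow> nat \<Rightarrow> 'a::{real_normed_field,euclidean_space}"
  assumes tri: "\<And>n k. n < k \<Longrightarrow> C n k = 0" and p: "\<And>k. 0 < p k" "\<And>k. p k \<le> 1"
  shows "maps_ell1 (maddox_l p) C \<longleftrightarrow>
    (\<exists>B. \<forall>G k. finite G \<longrightarrow> norm (\<Sum>n\<in>G. C n k) powr p k \<le> B)"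
    (is "_ \<longleftrightarrow> (\<exists>B. ?bound B)")
proof
  assume maps: "maps_ell1 (maddox_l p) C"
  have col: "summable (\<lambda>n. norm (C n k))" for k
    by (rule maps_ell1_column[OF tri maps maddox_l_unit])
  show "\<exists>B. ?bound B"
  proof (rule ccontr)
    assume neg: "\<not> (\<exists>B. ?bound B)"
    have "\<exists>z F N. finite F \<and> F \<subseteq> {K..} \<and> (\<forall>k. k \<notin> F \<longrightarrow> z k = 0) \<and>
      (\<Sum>k\<in>F. norm (z k) powr p k) \<le> (1 / 2) ^ i \<and> M \<le> (\<Sum>n<N. norm (tri_apply C z n))" for i K M
    proof -
      \<comment> \<open>The lower bound 1 gives \<open>m powr p k \<le> m\<close> for the exponent
        \<open>p k \<le> 1\<close>.\<close>
      define m where "m = max 1 M"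
      define A where "A = (\<Sum>k<K. (\<Sum>n. norm (C n k)) powr p k)"
      have A: "0 \<le> A" by (simp add: A_def sum_nonneg)
      \<comment> \<open>In this threshold \<open>A\<close> forces \<open>k\<close> past the first
        \<open>K\<close> columns, and \<open>2 ^ i\<close> makes up for the factor
        \<open>\<delta> powr p k = (1 / 2) ^ i\<close>.\<close>
      obtain G k where G: "finite G" and big: "2 ^ i * m + A < norm (\<Sum>n\<in>G. C n k) powr p k"
        using neg by (meson not_le)
      have "K \<le> k"
      proof (rule ccontr)
        assume "\<not> K \<le> k"
        then have "(\<Sum>n. norm (C n k)) powr p k \<le> A"
          unfolding A_def using \<open>\<not> K \<le> k\<close>
          by (intro member_le_sum[where f = "\<lambda>k. (\<Sum>n. norm (C n k)) powr p k"]) auto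
        moreover have "norm (\<Sum>n\<in>G. C n k) powr p k \<le> (\<Sum>n. norm (C n k)) powr p k"
          using p(1)[of k] sum_le_suminf_norm[OF col[of k] G] by (intro powr_mono2) auto
        moreover have "0 \<le> 2 ^ i * m" by (simp add: m_def)
        ultimately show False using big by linarith
      qed
      obtain N0 where N0: "G \<subseteq> {..<N0}"
        using G finite_nat_iff_bounded by blast
      define N where "N = max N0 (Suc k)"
      define \<delta> where "\<delta> = ((1 / 2) ^ i) powr (1 / p k)"
      define z :: "nat \<Rightarrow> 'a" where "z j = (if j = k then of_real \<delta> else 0)" for j
      have \<delta>: "\<delta> powr p k = (1 / 2) ^ i" "0 < \<delta>"
        using p(1)[of k] by (simp_all add: \<delta>_def powr_powr)
      define v where "v = norm (\<Sum>n\<in>G. C n k) * \<delta>"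
      have v0: "0 \<le> v" using \<delta> by (simp add: v_def)
      have "m \<le> v"
      proof (rule ccontr)
        assume "\<not> m \<le> v"
        then have "v powr p k \<le> m powr p k"
          using v0 p(1)[of k] by (intro powr_mono2) auto
        also have "\<dots> \<le> m powr 1"
          using p(2)[of k] by (intro powr_mono) (auto simp: m_def)
        finally have "v powr p k \<le> m" by (simp add: m_def)
        moreover have "v powr p k = norm (\<Sum>n\<in>G. C n k) powr p k * (1 / 2) ^ i"
          using \<delta> by (simp add: v_def powr_mult)
        ultimately have "norm (\<Sum>n\<in>G. C n k) powr p k \<le> 2 ^ i * m"
          by (simp add: power_one_over pos_divide_le_eq mult.commute)
        then show False using big A by linarith
      qed
      also have "v = norm (\<Sum>j<N. (\<Sum>n\<in>G. C n j) * z j)"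
      proof -
        have "(\<Sum>j<N. (\<Sum>n\<in>G. C n j) * z j) = (\<Sum>j\<in>{k}. (\<Sum>n\<in>G. C n j) * z j)"
          by (rule sum.mono_neutral_right) (auto simp: N_def z_def)
        then show ?thesis using \<delta> by (simp add: z_def v_def norm_mult)
      qed
      also have "\<dots> \<le> (\<Sum>n<N. norm (tri_apply C z n))"
        by (rule norm_sum_le_sum_norm_tri_apply[OF tri G]) (use N0 in \<open>auto simp: N_def\<close>)
      finally have "M \<le> (\<Sum>n<N. norm (tri_apply C z n))" by (simp add: m_def)
      then show ?thesis
        using \<open>K \<le> k\<close> \<delta> by (intro exI[of _ z] exI[of _ "{k}"] exI[of _ N]) (auto simp: z_def)
    qed
    then show False
      using gliding_hump_maddox_l[of C p, OF tri col] maps by blast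
  qed
next
  assume "\<exists>B. ?bound B"
  then obtain B0 where B0: "?bound B0" by blast
  define B where "B = max 1 B0"
  have B1: "1 \<le> B" by (simp add: B_def)
  have B: "norm (\<Sum>n\<in>G. C n k) powr p k \<le> B" if "finite G" for G k
    using B0 that unfolding B_def by (meson max.coboundedI2)
  show "maps_ell1 (maddox_l p) C"
    unfolding maps_ell1_def
  proof
    fix y :: "nat \<Rightarrow> 'a" assume "y \<in> maddox_l p"
    then have sm: "summable (\<lambda>k. norm (y k) powr p k)"
      by (simp add: maddox_l_def)
    have "\<forall>\<^sub>F k in sequentially. norm (y k) powr p k < 1 / B"
      by (rule order_tendstoD(2)[OF summable_LIMSEQ_zero[OF sm]]) (use B1 in auto)
    then obtain K where K: "\<And>k. k \<ge> K \<Longrightarrow> norm (y k) powr p k < 1 / B"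
      by (auto simp: eventually_sequentially)
    \<comment> \<open>\<open>D\<close> majorises the terms before \<open>K\<close>, where
      \<open>y\<close> may be large, independently of \<open>G\<close>.\<close>
    define D where "D k = (if k < K then B powr (1 / p k) * norm (y k) else 0)" for k
    have D0: "0 \<le> D k" for k by (simp add: D_def)
    show "summable (\<lambda>n. norm (tri_apply C y n))"
    proof (rule summable_tri_apply[OF tri])
      fix G :: "nat set" and N assume G: "finite G"
      have term_le: "norm (\<Sum>n\<in>G. C n k) * norm (y k) \<le> D k + B * norm (y k) powr p k" for k
      proof (cases "k < K")
        case True
        have "norm (\<Sum>n\<in>G. C n k) * norm (y k) \<le> D k"
          using True le_powr_inverse[OF norm_ge_zero p(1) B[OF G, of k]]
          by (simp add: D_def mult_right_mono)
        then show ?thesis using B1 by (simp add: add_increasing2)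
      next
        case False
        \<comment> \<open>By the choice of \<open>K\<close> the product has \<open>p k\<close>-th
          power at most 1, so it is itself at most 1 and raising it to \<open>p k\<close> does not
          decrease it.\<close>
        define u where "u = norm (\<Sum>n\<in>G. C n k) * norm (y k)"
        have u0: "0 \<le> u" by (simp add: u_def)
        have le: "u powr p k \<le> B * norm (y k) powr p k"
          using B[OF G, of k] by (simp add: u_def powr_mult mult_right_mono)
        also have "\<dots> \<le> 1"
          using K[of k] False B1 by (simp add: field_simps)
        finally have "u \<le> 1"
          using le_powr_inverse[OF u0 p(1)[of k], of 1] by simp
        then have "u \<le> u powr p k"
          using powr_mono'[of "p k" 1 u] p(2)[of k] u0 by simp
        then show ?thesis using le D0[of k] by (simp add: u_def)
      qed
      have "(\<Sum>k<N. norm (\<Sum>n\<in>G. C n k) * norm (y k)) \<le>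
          (\<Sum>k<N. D k) + B * (\<Sum>k<N. norm (y k) powr p k)"
        unfolding sum_distrib_left sum.distrib[symmetric] by (rule sum_mono) (rule term_le)
      also have "(\<Sum>k<N. D k) \<le> (\<Sum>k\<in>{..<N} \<union> {..<K}. D k)"
        by (rule sum_mono2) (auto simp: D0)
      also have "\<dots> = (\<Sum>k<K. D k)"
        by (rule sum.mono_neutral_right) (auto simp: D_def)
      also have "(\<Sum>k<N. norm (y k) powr p k) \<le> (\<Sum>k. norm (y k) powr p k)"
        by (rule sum_le_suminf[OF sm]) auto
      finally show "(\<Sum>k<N. norm (\<Sum>n\<in>G. C n k) * norm (y k)) \<le>
          (\<Sum>k<K. D k) + B * (\<Sum>k. norm (y k) powr p k)"
        using B1 by simp
    qed
  qed
qed

text \<open>The exponent \<open>p k / (p k - 1)\<close> is conjugate to \<open>p k\<close>.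
  Sufficiency is Young's inequality term by term, with the column sums scaled by
  \<open>1 / L\<close>. Necessity tests the matrix on extremal sequences normalised to cost at most
  \<open>(1 / 2) ^ i\<close>.\<close>

lemma maps_ell1_maddox_l_gt1_iff:
  fixes C :: "nat \<Rightarrow> nat \<Rightarrow> 'a::{real_normed_field,euclidean_space}"
  assumes tri: "\<And>n k. n < k \<Longrightarrow> C n k = 0" and p: "\<And>k. 1 < p k"
  shows "maps_ell1 (maddox_l p) C \<longleftrightarrow> (\<exists>L\<ge>1::nat. \<exists>B. \<forall>G N. finite G \<longrightarrow>
    (\<Sum>k<N. norm (\<Sum>n\<in>G. C n k * inverse (of_nat L)) powr (p k / (p k - 1))) \<le> B)"
    (is "_ \<longleftrightarrow> (\<exists>L\<ge>1. \<exists>B. ?bound L B)")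
proof -
  define q where "q k = p k / (p k - 1)" for k
  have q: "1 < q k" "(q k - 1) * p k = q k" "1 / q k + 1 / p k = 1" for k
    using p[of k] by (simp_all add: q_def divide_simps)
  have scale: "norm (\<Sum>n\<in>G. C n k * inverse (of_nat L)) = norm (\<Sum>n\<in>G. C n k) / real L" for G k L
    unfolding sum_distrib_right[symmetric] norm_mult norm_inverse by (simp add: divide_inverse)
  show ?thesis
  proof
    assume maps: "maps_ell1 (maddox_l p) C"
    have col: "summable (\<lambda>n. norm (C n k))" for k
      by (rule maps_ell1_column[OF tri maps maddox_l_unit])
    show "\<exists>L\<ge>1. \<exists>B. ?bound L B"
    proof (rule ccontr)
      assume neg: "\<not> (\<exists>L\<ge>1. \<exists>B. ?bound L B)"
      have "\<exists>z F N. finite F \<and> F \<subseteq> {K..} \<and> (\<forall>k. k \<notin> F \<longrightarrow> z k = 0) \<and>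
        (\<Sum>k\<in>F. norm (z k) powr p k) \<le> (1 / 2) ^ i \<and> M \<le> (\<Sum>n<N. norm (tri_apply C z n))" for i K M
      proof -
        \<comment> \<open>The pairing below comes out as \<open>L * (1 / 2) ^ i\<close>, which has
          to reach \<open>M\<close>.\<close>
        obtain l :: nat where l: "M * 2 ^ i \<le> real l"
          using real_arch_simple by blast
        define L where "L = Suc l"
        have L: "1 \<le> L" "0 < real L" "M * 2 ^ i \<le> real L"
          using l by (auto simp: L_def)
        define A where "A = (\<Sum>k<K. ((\<Sum>n. norm (C n k)) / L) powr q k)"
        \<comment> \<open>\<open>A\<close> bounds the columns before \<open>K\<close>; the
          additional 1 yields \<open>\<sigma> > 1\<close> and hence
          \<open>\<tau> \<le> 1\<close>.\<close>
        have "\<not> ?bound L (A + 1)"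
          using neg L(1) by blast
        then obtain G N0 where G: "finite G"
          and N0: "A + 1 < (\<Sum>k<N0. (norm (\<Sum>n\<in>G. C n k) / L) powr q k)"
          unfolding scale q_def by (meson not_le)
        obtain N1 where N1: "G \<subseteq> {..<N1}"
          using G finite_nat_iff_bounded by blast
        define N where "N = Max {N0, N1, K}"
        have N: "N0 \<le> N" "N1 \<le> N" "K \<le> N" by (auto simp: N_def)
        define b where "b k = (\<Sum>n\<in>G. C n k)" for k
        define h where "h k = (norm (b k) / L) powr q k" for k
        define \<sigma> where "\<sigma> = (\<Sum>k\<in>{K..<N}. h k)"
        have "A + 1 < (\<Sum>k<N0. h k)" using N0 by (simp add: h_def b_def)
        also have "\<dots> \<le> (\<Sum>k<N. h k)"
          by (rule sum_mono2) (use N in \<open>auto simp: h_def\<close>)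
        also have "\<dots> = (\<Sum>k<K. h k) + \<sigma>"
          unfolding \<sigma>_def using N(3) by (subst sum.union_disjoint[symmetric]) (auto simp: ivl_disj_un)
        also have "(\<Sum>k<K. h k) \<le> A"
          unfolding A_def h_def b_def
        proof (rule sum_mono)
          fix k
          show "(norm (\<Sum>n\<in>G. C n k) / L) powr q k \<le> ((\<Sum>n. norm (C n k)) / L) powr q k"
            using q(1)[of k] L sum_le_suminf_norm[OF col[of k] G]
            by (intro powr_mono2 divide_right_mono) auto
        qed
        finally have \<sigma>: "1 < \<sigma>" by simp
        define \<tau> where "\<tau> = (1 / 2) ^ i / \<sigma>"
        have "(1 / 2 :: real) ^ i \<le> 1" by (simp add: power_le_one)
        then have \<tau>: "0 < \<tau>" "\<tau> \<le> 1" "\<tau> * \<sigma> = (1 / 2) ^ i"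
          using \<sigma> by (auto simp: \<tau>_def divide_le_eq)
        \<comment> \<open>The extremal sequence in Hoelder's inequality for \<open>b / L\<close>, times \<open>\<tau>\<close>.\<close>
        define z :: "nat \<Rightarrow> 'a" where "z k = (if K \<le> k \<and> k < N
          then of_real (\<tau> * (norm (b k) / L) powr (q k - 1)) * (of_real (norm (b k)) / b k) else 0)" for k
        \<comment> \<open>The quotient \<open>norm (b k) / b k\<close> removes the phase of
          \<open>b k\<close>, so all products are nonnegative reals and nothing cancels in their
          sum. If \<open>b k = 0\<close>, then \<open>h k = 0\<close> and both sides vanish.\<close>
        have bz: "b k * z k = of_real (\<tau> * L * h k)" if "k \<in> {K..<N}" for k
        proof (cases "b k = 0")
          case False
          have "b k * z k = of_real (\<tau> * ((norm (b k) / L) powr (q k - 1) * norm (b k)))"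
            using False that by (simp add: z_def)
          also have "(norm (b k) / L) powr (q k - 1) * norm (b k) = L * h k"
            using False L by (simp add: h_def powr_diff)
          finally show ?thesis by (simp add: mult_ac)
        qed (simp add: h_def)
        \<comment> \<open>Since \<open>(q k - 1) * p k = q k\<close>, the power is at most
          \<open>\<tau> powr p k * h k\<close>, and \<open>\<tau> \<le> 1 < p k\<close> gives
          \<open>\<tau> powr p k \<le> \<tau>\<close>.\<close>
        have nz: "norm (z k) powr p k \<le> \<tau> * h k" if "k \<in> {K..<N}" for k
        proof -
          have "norm (z k) \<le> \<tau> * (norm (b k) / L) powr (q k - 1)"
            using \<tau> that by (cases "b k = 0") (auto simp: z_def norm_mult norm_divide)
          then have "norm (z k) powr p k \<le> (\<tau> * (norm (b k) / L) powr (q k - 1)) powr p k"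
            using p[of k] by (intro powr_mono2) auto
          also have "\<dots> = \<tau> powr p k * h k"
            using \<tau> by (simp add: powr_mult powr_powr q(2) h_def)
          also have "\<dots> \<le> \<tau> * h k"
            using powr_mono'[of 1 "p k" \<tau>] \<tau> p[of k] by (intro mult_right_mono) (auto simp: h_def)
          finally show ?thesis .
        qed
        have "(\<Sum>k\<in>{K..<N}. norm (z k) powr p k) \<le> \<tau> * \<sigma>"
          unfolding \<sigma>_def sum_distrib_left by (rule sum_mono) (rule nz)
        then have small: "(\<Sum>k\<in>{K..<N}. norm (z k) powr p k) \<le> (1 / 2) ^ i"
          by (simp add: \<tau>)
        have "(\<Sum>k<N. b k * z k) = (\<Sum>k\<in>{K..<N}. b k * z k)"
          by (rule sum.mono_neutral_right) (auto simp: z_def)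
        also have "\<dots> = (\<Sum>k\<in>{K..<N}. of_real (\<tau> * L * h k))"
          by (intro sum.cong refl bz)
        also have "\<dots> = of_real (L * (\<tau> * \<sigma>))"
          by (simp add: \<sigma>_def sum_distrib_left mult_ac)
        finally have "norm (\<Sum>k<N. b k * z k) = L * (1 / 2) ^ i"
          using \<tau>(3) by (simp add: norm_mult norm_power norm_divide)
        moreover have "M \<le> L * (1 / 2) ^ i"
          using L(3) by (simp add: power_one_over pos_le_divide_eq)
        moreover have "norm (\<Sum>k<N. b k * z k) \<le> (\<Sum>n<N. norm (tri_apply C z n))"
          unfolding b_def
          by (rule norm_sum_le_sum_norm_tri_apply[OF tri G]) (use N1 N in auto)
        ultimately have "M \<le> (\<Sum>n<N. norm (tri_apply C z n))" by simp
        then show ?thesis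
          using small by (intro exI[of _ z] exI[of _ "{K..<N}"] exI[of _ N]) (auto simp: z_def)
      qed
      then show False
        using gliding_hump_maddox_l[of C p, OF tri col] maps by blast
    qed
  next
    assume "\<exists>L\<ge>1. \<exists>B. ?bound L B"
    then obtain L B where L: "1 \<le> L" and B: "?bound L B" by blast
    show "maps_ell1 (maddox_l p) C"
      unfolding maps_ell1_def
    proof
      fix y :: "nat \<Rightarrow> 'a" assume "y \<in> maddox_l p"
      then have sm: "summable (\<lambda>k. norm (y k) powr p k)"
        by (simp add: maddox_l_def)
      show "summable (\<lambda>n. norm (tri_apply C y n))"
      proof (rule summable_tri_apply[OF tri])
        fix G :: "nat set" and N assume G: "finite G"
        define \<beta> where "\<beta> k = norm (\<Sum>n\<in>G. C n k) / L" for k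
        have term_le: "norm (\<Sum>n\<in>G. C n k) * norm (y k) \<le> L * (\<beta> k powr q k + norm (y k) powr p k)" for k
        proof -
          have "\<beta> k * norm (y k) \<le> \<beta> k powr q k / q k + norm (y k) powr p k / p k"
            using q[of k] p[of k] by (intro Youngs_inequality) (auto simp: \<beta>_def)
          \<comment> \<open>Both exponents exceed 1, so the divisors from Young's inequality can be
            replaced by 1.\<close>
          also have "\<dots> \<le> \<beta> k powr q k / 1 + norm (y k) powr p k / 1"
            using q(1)[of k] p[of k] by (intro add_mono divide_left_mono) auto
          finally have "L * (\<beta> k * norm (y k)) \<le> L * (\<beta> k powr q k + norm (y k) powr p k)"
            by (intro mult_left_mono) auto
          then show ?thesis using L by (simp add: \<beta>_def)
        qed
        have "(\<Sum>k<N. norm (\<Sum>n\<in>G. C n k) * norm (y k)) \<le>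
            L * ((\<Sum>k<N. \<beta> k powr q k) + (\<Sum>k<N. norm (y k) powr p k))"
          unfolding sum.distrib[symmetric] sum_distrib_left by (rule sum_mono) (rule term_le)
        also have "\<dots> \<le> L * (B + (\<Sum>k. norm (y k) powr p k))"
        proof (intro mult_left_mono add_mono)
          show "(\<Sum>k<N. \<beta> k powr q k) \<le> B"
            using B G unfolding scale \<beta>_def q_def by blast
          show "(\<Sum>k<N. norm (y k) powr p k) \<le> (\<Sum>k. norm (y k) powr p k)"
            by (rule sum_le_suminf[OF sm]) auto
        qed simp
        finally show "(\<Sum>k<N. norm (\<Sum>n\<in>G. C n k) * norm (y k)) \<le>
            L * (B + (\<Sum>k. norm (y k) powr p k))" .
      qed
    qed
  qed
qed

subsection \<open>Finiteness of the extended suprema\<close>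

lemma SUP_SUP_ennreal_less_top_iff:
  assumes "\<And>i k. 0 \<le> f i k"
  shows "(SUP i\<in>{i. P i}. SUP k. ennreal (f i k)) < \<infinity> \<longleftrightarrow> (\<exists>B. \<forall>i k. P i \<longrightarrow> f i k \<le> B)"
proof
  assume "(SUP i\<in>{i. P i}. SUP k. ennreal (f i k)) < \<infinity>"
  then obtain B where B: "0 \<le> B" "(SUP i\<in>{i. P i}. SUP k. ennreal (f i k)) = ennreal B"
    by (cases "SUP i\<in>{i. P i}. SUP k. ennreal (f i k)") auto
  have "f i k \<le> B" if "P i" for i k
  proof -
    have "ennreal (f i k) \<le> (SUP k. ennreal (f i k))"
      by (rule SUP_upper) simp
    also have "\<dots> \<le> ennreal B"
      unfolding B(2)[symmetric] by (rule SUP_upper) (simp add: that)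
    finally show ?thesis using B(1) by simp
  qed
  then show "\<exists>B. \<forall>i k. P i \<longrightarrow> f i k \<le> B" by blast
next
  assume "\<exists>B. \<forall>i k. P i \<longrightarrow> f i k \<le> B"
  then obtain B where B: "\<And>i k. P i \<Longrightarrow> f i k \<le> B" by blast
  have "(SUP i\<in>{i. P i}. SUP k. ennreal (f i k)) \<le> ennreal B"
    using B by (intro SUP_least ennreal_leI) simp
  also have "\<dots> < \<infinity>" by simp
  finally show "(SUP i\<in>{i. P i}. SUP k. ennreal (f i k)) < \<infinity>" .
qed

text \<open>An extended series is the supremum of its partial sums, so finiteness of the outer
  supremum is one real bound uniform in the index and the cut-off.\<close>

lemma SUP_suminf_ennreal_less_top_iff:
  assumes "\<And>i n. 0 \<le> g i n"
  shows "(SUP i\<in>{i. P i}. \<Sum>n. ennreal (g i n)) < \<infinity> \<longleftrightarrow>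
    (\<exists>B. \<forall>i N. P i \<longrightarrow> (\<Sum>n<N. g i n) \<le> B)"
proof
  assume "(SUP i\<in>{i. P i}. \<Sum>n. ennreal (g i n)) < \<infinity>"
  then obtain B where B: "0 \<le> B" "(SUP i\<in>{i. P i}. \<Sum>n. ennreal (g i n)) = ennreal B"
    by (cases "SUP i\<in>{i. P i}. \<Sum>n. ennreal (g i n)") auto
  have "(\<Sum>n<N. g i n) \<le> B" if "P i" for i N
  proof -
    have "ennreal (\<Sum>n<N. g i n) = (\<Sum>n<N. ennreal (g i n))"
      using assms by simp
    also have "\<dots> \<le> (\<Sum>n. ennreal (g i n))"
      by (rule sum_le_suminf) auto
    also have "\<dots> \<le> ennreal B"
      unfolding B(2)[symmetric] by (rule SUP_upper) (simp add: that)
    finally show ?thesis using B(1) by simp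
  qed
  then show "\<exists>B. \<forall>i N. P i \<longrightarrow> (\<Sum>n<N. g i n) \<le> B" by blast
next
  assume "\<exists>B. \<forall>i N. P i \<longrightarrow> (\<Sum>n<N. g i n) \<le> B"
  then obtain B where B: "\<And>i N. P i \<Longrightarrow> (\<Sum>n<N. g i n) \<le> B" by blast
  have "(\<Sum>n<N. ennreal (g i n)) \<le> ennreal B" if "P i" for i N
    using B[OF that, of N] assms by (simp add: ennreal_leI)
  then have "(SUP i\<in>{i. P i}. \<Sum>n. ennreal (g i n)) \<le> ennreal B"
    by (intro SUP_least) (simp add: suminf_eq_SUP SUP_least)
  also have "\<dots> < \<infinity>" by simp
  finally show "(SUP i\<in>{i. P i}. \<Sum>n. ennreal (g i n)) < \<infinity>" .
qed

lemma mem_H1_iff: "a \<in> H1 r s t p \<longleftrightarrow> (\<exists>L\<ge>1. \<exists>B. \<forall>F N. finite F \<longrightarrow>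
    (\<Sum>n<N. norm (\<Sum>k\<in>F. hterm r s t a n k * of_real (real L powr (- 1 / p k)))) \<le> B)"
  unfolding H1_def UN_iff mem_Collect_eq Bex_def atLeast_iff SUP_suminf_ennreal_less_top_iff[OF norm_ge_zero]
  by (rule refl)

lemma mem_H2_iff: "a \<in> H2 r s t p \<longleftrightarrow> summable (\<lambda>n. norm (tri_apply (hterm r s t a) (\<lambda>_. 1) n))"
proof -
  \<comment> \<open>\<open>hterm\<close> vanishes above the diagonal, so the inner series is a
    finite row sum.\<close>
  have "(\<Sum>k. hterm r s t a n k) = tri_apply (hterm r s t a) (\<lambda>_. 1) n" for n
    by (subst suminf_finite[of "{..n}"]) (auto simp: tri_apply_def hterm_eq_0)
  then have "a \<in> H2 r s t p \<longleftrightarrow>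
      (\<Sum>n. ennreal (norm (tri_apply (hterm r s t a) (\<lambda>_. 1) n))) \<noteq> \<infinity>"
    by (simp only: H2_def mem_Collect_eq less_top infinity_ennreal_def)
  also have "\<dots> \<longleftrightarrow> summable (\<lambda>n. norm (tri_apply (hterm r s t a) (\<lambda>_. 1) n))"
  proof
    assume "(\<Sum>n. ennreal (norm (tri_apply (hterm r s t a) (\<lambda>_. 1) n))) \<noteq> \<infinity>"
    then show "summable (\<lambda>n. norm (tri_apply (hterm r s t a) (\<lambda>_. 1) n))"
      by (rule summable_suminf_not_top[folded infinity_ennreal_def, OF norm_ge_zero])
  next
    assume "summable (\<lambda>n. norm (tri_apply (hterm r s t a) (\<lambda>_. 1) n))"
    then show "(\<Sum>n. ennreal (norm (tri_apply (hterm r s t a) (\<lambda>_. 1) n))) \<noteq> \<infinity>"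
      by (rule ennreal_suminf_neq_top[folded infinity_ennreal_def, OF _ norm_ge_zero])
  qed
  finally show ?thesis .
qed

lemma mem_H3_iff: "a \<in> H3 r s t p \<longleftrightarrow> (\<forall>L\<ge>1. \<exists>B. \<forall>F N. finite F \<longrightarrow>
    (\<Sum>n<N. norm (\<Sum>k\<in>F. hterm r s t a n k * of_real (real L powr (1 / p k)))) \<le> B)"
  unfolding H3_def INT_iff mem_Collect_eq Ball_def atLeast_iff SUP_suminf_ennreal_less_top_iff[OF norm_ge_zero]
  by (rule refl)

lemma mem_H4_iff: "a \<in> H4 r s t p \<longleftrightarrow>
    (\<exists>B. \<forall>G k. finite G \<longrightarrow> norm (\<Sum>n\<in>G. hterm r s t a n k) powr p k \<le> B)"
  unfolding H4_def mem_Collect_eq SUP_SUP_ennreal_less_top_iff[OF powr_ge_zero]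
  by (rule refl)

lemma mem_H5_iff: "a \<in> H5 r s t p \<longleftrightarrow> (\<exists>L\<ge>1. \<exists>B. \<forall>G N. finite G \<longrightarrow>
    (\<Sum>k<N. norm (\<Sum>n\<in>G. hterm r s t a n k * inverse (of_nat L)) powr (p k / (p k - 1))) \<le> B)"
  unfolding H5_def UN_iff mem_Collect_eq Bex_def atLeast_iff SUP_suminf_ennreal_less_top_iff[OF powr_ge_zero]
  by (rule refl)

section \<open>The \<alpha>-duals of the mean difference spaces\<close>

theorem theorem4p3:
  fixes r s t :: "nat \<Rightarrow> 'a::{real_normed_field,euclidean_space}"
    and p :: "nat \<Rightarrow> real"
  assumes "r \<in> seqs_nonzero" and "t \<in> seqs_nonzero" and "s \<in> seqs_nonzero0"
    and "\<And>k. p k > 0" and "bdd_above (range p)"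
  shows "((\<forall>k. p k > 1) \<longrightarrow> alpha_dual (mean_diff_space (maddox_l p) r s t) = H5 r s t p)
    \<and> ((\<forall>k. p k \<le> 1) \<longrightarrow> alpha_dual (mean_diff_space (maddox_l p) r s t) = H4 r s t p)
    \<and> alpha_dual (mean_diff_space (maddox_c0 p) r s t) = H1 r s t p
    \<and> alpha_dual (mean_diff_space (maddox_c p) r s t) = H1 r s t p \<inter> H2 r s t p
    \<and> alpha_dual (mean_diff_space (maddox_linf p) r s t) = H3 r s t p"
proof -
  have dual: "a \<in> alpha_dual (mean_diff_space X r s t) \<longleftrightarrow> maps_ell1 X (hterm r s t a)" for a X
    using assms(1-3)
    by (intro alpha_dual_mean_diff_space) (auto simp: seqs_nonzero_def seqs_nonzero0_def)
  note p = assms(4)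
  have l_gt1: "alpha_dual (mean_diff_space (maddox_l p) r s t) = H5 r s t p" if "\<forall>k. p k > 1"
    by (rule Set.set_eqI, unfold dual mem_H5_iff, rule maps_ell1_maddox_l_gt1_iff[OF _ that[rule_format]])
      (rule hterm_eq_0)
  have l_le1: "alpha_dual (mean_diff_space (maddox_l p) r s t) = H4 r s t p" if "\<forall>k. p k \<le> 1"
    by (rule Set.set_eqI, unfold dual mem_H4_iff, rule maps_ell1_maddox_l_le1_iff[OF _ p that[rule_format]])
      (rule hterm_eq_0)
  have c0: "alpha_dual (mean_diff_space (maddox_c0 p) r s t) = H1 r s t p"
    by (rule Set.set_eqI, unfold dual mem_H1_iff, rule maps_ell1_maddox_c0_iff[OF _ p]) (rule hterm_eq_0)
  have c: "alpha_dual (mean_diff_space (maddox_c p) r s t) = H1 r s t p \<inter> H2 r s t p"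
    \<comment> \<open>Folding \<open>H1\<close> back into the dual for \<open>maddox_c0\<close>
      turns the claim into the splitting of \<open>maddox_c\<close> into null sequences and
      constants.\<close>
    unfolding c0[symmetric]
    by (rule Set.set_eqI) (simp only: Int_iff dual mem_H2_iff maps_ell1_maddox_c_iff)
  have linf: "alpha_dual (mean_diff_space (maddox_linf p) r s t) = H3 r s t p"
    by (rule Set.set_eqI, unfold dual mem_H3_iff, rule maps_ell1_maddox_linf_iff[OF _ p]) (rule hterm_eq_0)
  show ?thesis
    using l_gt1 l_le1 c0 c linf by blast
qed

end
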